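(* Let $f_1,\dots,f_N:\mathbb R^m\to\mathbb R$ be differentiable, where each $\nabla f_i$ is $l_i$-Lipschitz continuous on $\mathbb R^m$, and suppose that $\tilde f=\sum_{i=1}^N f_i$ is $\mu$-strongly convex on $\mathbb R^m$ (the individual $f_i$ need not be convex). Communication graphs are strongly connected weighted digraphs on $N$ nodes (not necessarily weight-balanced). Let $\alpha,\beta>0$ satisfy $\alpha^2>4\beta$, and consider the primal-dual dynamics $$\dot{\bm x}=-\gamma\nabla\bar f(\bm x)-\bm L\bm z-\alpha\bm L\bm x,\qquad \dot{\bm z}=\beta\bm L\bm x,$$ with notation as in the context. Then convergence can be ensured by choosing either the gain $\gamma$ or the graph $\mathcal G$: (a) for any given strongly connected digraph $\mathcal G$, there exists a gain $\gamma>0$, and (b) for any given gain $\gamma>0$, there exists a strongly connected communication digraph $\mathcal G$ on $N$ nodes, such that every trajectory $(\bm x(t),\bm z(t))$ of the dynamics converges with an exponential rate to an equilibrium $(\bm x^*,\bm z^* )$ of the dynamics, where $\bm x^*=\bm 1_N\otimes x^*$ and $x^*$ is the optimal solution of $\min_{x\in\mathbb R^m}\tilde f(x)$.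
   Context: $\otimes$ is the Kronecker product and $\bm 1_N\in\mathbb R^N$ is the all-ones vector. A differentiable $g:\mathbb R^m\to\mathbb R$ is $\mu$-strongly convex ($\mu>0$) if $\langle y-x,\nabla g(y)-\nabla g(x)\rangle\ge\mu\|x-y\|^2$ for all $x,y$. A weighted digraph $\mathcal G$ on $\{1,\dots,N\}$ has adjacency matrix $[a_{ij}]$ with $a_{ij}>0$ if $(j,i)$ is an edge and $a_{ij}=0$ otherwise, with $a_{ii}=0$; its Laplacian is $L_G=\mathrm{diag}\{d_1,\dots,d_N\}-[a_{ij}]$, $d_i=\sum_j a_{ij}$. It is strongly connected if there is a directed path between any pair of distinct nodes; then there is a unique vector $r=[r_i]\in\mathbb R^N$ with all entries positive such that $r^\top L_G=\bm 0$ and $\bm 1_N^\top r=1$. Put $\tilde m=Nm$, $\bm L=L_G\otimes I_m$, $\bm x=[x_1^\top,\dots,x_N^\top]^\top\in\mathbb R^{\tilde m}$, $\bm z=[z_1^\top,\dots,z_N^\top]^\top\in\mathbb R^{\tilde m}$, $\bar f_i=\frac1{r_i}f_i$, and $\nabla\bar f(\bm x)=[\nabla\bar f_1(x_1)^\top,\dots,\nabla\bar f_N(x_N)^\top]^\top$. Note that $r$, $\bm L$ and $\bar f_i$ depend on $\mathcal G$. The scalars $\alpha,\beta,\gamma$ are positive algorithm gains. An equilibrium $(\bm x^*,\bm z^* )$ satisfies $\gamma\nabla\bar f(\bm x^* )+\bm L\bm z^*=\bm 0$ and $\bm L\bm x^*=\bm 0$. Convergence with an exponential rate means that there exist constants $C,\kappa>0$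 (where $C$ may depend on the trajectory) with $\|(\bm x(t),\bm z(t))-(\bm x^*,\bm z^* )\|\le Ce^{-\kappa t}$ for all $t\ge0$. *)

theory Defs
  imports "HOL-Analysis.Analysis"
begin

text \<open>
  Nodes are the elements of a finite type \<open>'n\<close>, so that N is \<open>CARD('n)\<close>, and
  decision vectors have type \<open>real ^ 'm\<close>. The stacked space of dimension N m is
  \<open>real ^ ('n \<times> 'm)\<close>, where component \<open>(i, k)\<close> is the k-th entry of the i-th block.
\<close>

definition grad :: "('a::real_inner \<Rightarrow> real) \<Rightarrow> 'a \<Rightarrow> 'a" where
  "grad g x = (THE D. GDERIV g x :> D)"

lemma grad_eqI:
  assumes "GDERIV g x :> D"
  shows "grad g x = D"
  unfolding grad_def
proof (rule the_equality)
  show "GDERIV g x :> D" by (fact assms)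
next
  fix E assume "GDERIV g x :> E"
  then have "(\<lambda>h. h \<bullet> E) = (\<lambda>h. h \<bullet> D)"
    using assms unfolding gderiv_def by (rule has_derivative_unique)
  then show "E = D"
    by (simp add: fun_eq_iff vector_eq_ldot)
qed

definition strongly_convex :: "real \<Rightarrow> ('a::real_inner \<Rightarrow> real) \<Rightarrow> bool" where
  "strongly_convex \<mu> g \<longleftrightarrow>
     \<mu> > 0 \<and> (\<forall>x. g differentiable (at x)) \<and>
     (\<forall>x y. (y - x) \<bullet> (grad g y - grad g x) \<ge> \<mu> * (norm (x - y))\<^sup>2)"


text \<open>
  A weighted digraph is given by its adjacency matrix, which determines the edge set;
  \<open>A $ i $ j\<close> is the weight of the edge from j to i.
\<close>

definition weighted_digraph :: "real ^ 'n ^ 'n \<Rightarrow> bool" where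
  "weighted_digraph A \<longleftrightarrow> (\<forall>i j. A $ i $ j \<ge> 0) \<and> (\<forall>i. A $ i $ i = 0)"

definition edges :: "real ^ 'n ^ 'n \<Rightarrow> ('n \<times> 'n) set" where
  "edges A = {(j, i). A $ i $ j > 0}"

definition strongly_connected :: "real ^ 'n ^ 'n \<Rightarrow> bool" where
  "strongly_connected A \<longleftrightarrow> (\<forall>i j. i \<noteq> j \<longrightarrow> (i, j) \<in> (edges A)\<^sup>+)"

definition laplacian :: "real ^ 'n ^ 'n \<Rightarrow> real ^ 'n ^ 'n" where
  "laplacian A = (\<chi> i j. (if i = j then \<Sum>k\<in>UNIV. A $ i $ k else 0) - A $ i $ j)"

text \<open>The vector below exists and is unique when the digraph is strongly connected.\<close>

definition left_null_vector :: "real ^ 'n ^ 'n \<Rightarrow> real ^ 'n" where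
  "left_null_vector A =
     (THE r. (\<forall>i. r $ i > 0) \<and> r v* laplacian A = 0 \<and> 1 \<bullet> r = 1)"


definition kronecker ::
    "real ^ 'b::finite ^ 'a::finite \<Rightarrow> real ^ 'd::finite ^ 'c::finite \<Rightarrow> real ^ ('b \<times> 'd) ^ ('a \<times> 'c)" where
  "kronecker A B = (\<chi> p q. A $ fst p $ fst q * B $ snd p $ snd q)"

definition kronecker_vec :: "real ^ 'a::finite \<Rightarrow> real ^ 'b::finite \<Rightarrow> real ^ ('a \<times> 'b)" where
  "kronecker_vec u v = (\<chi> p. u $ fst p * v $ snd p)"

definition block :: "real ^ ('n::finite \<times> 'm::finite) \<Rightarrow> 'n \<Rightarrow> real ^ 'm" where
  "block x i = (\<chi> k. x $ (i, k))"

definition stacked_laplacian ::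
    "real ^ 'n::finite ^ 'n \<Rightarrow> real ^ ('n \<times> 'm::finite) ^ ('n \<times> 'm)" where
  "stacked_laplacian A = kronecker (laplacian A) (mat 1)"

definition scaled_cost ::
    "('n::finite \<Rightarrow> real ^ 'm::finite \<Rightarrow> real) \<Rightarrow> real ^ 'n ^ 'n \<Rightarrow> 'n \<Rightarrow> real ^ 'm \<Rightarrow> real" where
  "scaled_cost f A i = (\<lambda>y. (1 / left_null_vector A $ i) * f i y)"

definition stacked_grad ::
    "('n::finite \<Rightarrow> real ^ 'm::finite \<Rightarrow> real) \<Rightarrow> real ^ ('n \<times> 'm) \<Rightarrow> real ^ ('n \<times> 'm)" where
  "stacked_grad F x = (\<chi> p. grad (F (fst p)) (block x (fst p)) $ snd p)"


definition trajectory ::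
    "('n::finite \<Rightarrow> real ^ 'm::finite \<Rightarrow> real) \<Rightarrow> real ^ 'n ^ 'n \<Rightarrow> real \<Rightarrow> real \<Rightarrow> real \<Rightarrow>
     (real \<Rightarrow> real ^ ('n \<times> 'm)) \<Rightarrow> (real \<Rightarrow> real ^ ('n \<times> 'm)) \<Rightarrow> bool" where
  "trajectory f A \<alpha> \<beta> \<gamma> x z \<longleftrightarrow>
     (\<forall>t\<ge>0.
        (x has_vector_derivative
           - (\<gamma> *\<^sub>R stacked_grad (scaled_cost f A) (x t)) - stacked_laplacian A *v z t
             - \<alpha> *\<^sub>R (stacked_laplacian A *v x t)) (at t within {0..}) \<and>
        (z has_vector_derivative
           \<beta> *\<^sub>R (stacked_laplacian A *v x t)) (at t within {0..}))"

definition equilibrium ::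
    "('n::finite \<Rightarrow> real ^ 'm::finite \<Rightarrow> real) \<Rightarrow> real ^ 'n ^ 'n \<Rightarrow> real \<Rightarrow>
     real ^ ('n \<times> 'm) \<Rightarrow> real ^ ('n \<times> 'm) \<Rightarrow> bool" where
  "equilibrium f A \<gamma> xs zs \<longleftrightarrow>
     \<gamma> *\<^sub>R stacked_grad (scaled_cost f A) xs + stacked_laplacian A *v zs = 0 \<and>
     stacked_laplacian A *v xs = 0"

text \<open>
  The rate \<open>\<kappa>\<close> is common to all trajectories, whereas the constant \<open>C\<close> and the limit \<open>zs\<close>
  may depend on the trajectory. The norm on pairs is the Euclidean one.
\<close>

definition all_trajectories_converge ::
    "('n::finite \<Rightarrow> real ^ 'm::finite \<Rightarrow> real) \<Rightarrow> real ^ 'n ^ 'n \<Rightarrow> real \<Rightarrow> real \<Rightarrow> real \<Rightarrow> real ^ 'm \<Rightarrow> bool" where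
  "all_trajectories_converge f A \<alpha> \<beta> \<gamma> xopt \<longleftrightarrow>
     (\<exists>\<kappa>>0. \<forall>x z. trajectory f A \<alpha> \<beta> \<gamma> x z \<longrightarrow>
        (\<exists>xs zs. equilibrium f A \<gamma> xs zs \<and> xs = kronecker_vec 1 xopt \<and>
           (\<exists>C>0. \<forall>t\<ge>0. norm ((x t, z t) - (xs, zs)) \<le> C * exp (- \<kappa> * t))))"

end

theory Submission
  imports Defs
begin

text \<open>
  Write \<open>\<alpha> = a + b\<close> and \<open>\<beta> = a b\<close> with \<open>a > b > 0\<close>, which is possible because \<open>\<alpha>\<^sup>2 > 4 \<beta>\<close>. The
  variables \<open>u = x + z / a\<close> and \<open>v = x + z / b\<close>, measured from the equilibrium whose weighted
  average of z agrees with the conserved one, decouple the Laplacian terms: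
  \<open>u' = - \<gamma> G - a L u\<close>, \<open>v' = - \<gamma> G - b L v\<close>, where \<open>x = (a u - b v) / (a - b)\<close>. In the norm
  weighted by the left null vector r the Laplacian dissipates the disagreement, strong convexity of
  the sum of the costs dissipates the common weighted average of u and v, and for small \<open>\<gamma>\<close> these two
  dominate the cross terms. So the squared norm of (u, v) decays exponentially. Multiplying the graph
  and \<open>\<gamma>\<close> by the same factor leaves r unchanged and merely rescales time, so that a small gain
  on a given graph can be exchanged for large weights under a given gain.
\<close>

subsection \<open>Strongly convex functions\<close>

text \<open>The derivative is a linear functional on a Euclidean space, so it is the inner product
  with the vector whose coordinates are its values on the basis. Hence the definite description
  \<open>grad\<close> denotes wherever \<open>g\<close> is differentiable.\<close>

lemma gderiv_grad:
  fixes g :: "'a::euclidean_space \<Rightarrow> real"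
  assumes "g differentiable (at x)"
  shows "GDERIV g x :> grad g x"
proof -
  obtain D where D: "(g has_derivative D) (at x)"
    using assms by (auto simp: differentiable_def)
  interpret bounded_linear D by (fact has_derivative_bounded_linear[OF D])
  have "D h = h \<bullet> (\<Sum>b\<in>Basis. D b *\<^sub>R b)" for h
  proof -
    have "D h = D (\<Sum>b\<in>Basis. (h \<bullet> b) *\<^sub>R b)" by (simp add: euclidean_representation)
    also have "\<dots> = (\<Sum>b\<in>Basis. (h \<bullet> b) * D b)" by (simp add: sum scaleR)
    finally show ?thesis by (simp add: inner_sum_right mult.commute)
  qed
  then have "GDERIV g x :> (\<Sum>b\<in>Basis. D b *\<^sub>R b)"
    using D unfolding gderiv_def by (metis (no_types, lifting) has_derivative_eq_rhs ext)
  then show ?thesis by (metis grad_eqI)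
qed

text \<open>Strong monotonicity of the gradient is integrated along the segment from
  \<open>x\<close> to \<open>y\<close>. It turns the pairwise inequality of the definition into
  quadratic growth above the tangent plane.\<close>

lemma strongly_convex_lower_bound:
  fixes g :: "'a::euclidean_space \<Rightarrow> real"
  assumes "strongly_convex \<mu> g"
  shows "g y \<ge> g x + (y - x) \<bullet> grad g x + \<mu> / 2 * (norm (y - x))\<^sup>2"
proof -
  define h where "h = y - x"
  \<comment> \<open>The gap between \<open>g\<close> and the claimed bound along the segment, up to
    the constant \<open>g x\<close>; the claim is \<open>\<phi> 0 \<le> \<phi> 1\<close>.\<close>
  define \<phi> where "\<phi> t = g (x + t *\<^sub>R h) - t * (h \<bullet> grad g x) - \<mu> / 2 * t\<^sup>2 * (norm h)\<^sup>2" for t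
  have deriv: "(\<phi> has_real_derivative
      h \<bullet> grad g (x + t *\<^sub>R h) - h \<bullet> grad g x - \<mu> * t * (norm h)\<^sup>2) (at t)" for t
  proof -
    have "GDERIV g (x + t *\<^sub>R h) :> grad g (x + t *\<^sub>R h)"
      using assms by (intro gderiv_grad) (auto simp: strongly_convex_def)
    then have 1: "(g has_derivative (\<lambda>k. k \<bullet> grad g (x + t *\<^sub>R h))) (at (x + t *\<^sub>R h))"
      by (simp add: gderiv_def)
    have 2: "((\<lambda>t. x + t *\<^sub>R h) has_derivative (\<lambda>s. s *\<^sub>R h)) (at t)"
      by (auto intro!: derivative_eq_intros)
    have "((\<lambda>t. g (x + t *\<^sub>R h)) has_derivative (\<lambda>s. (s *\<^sub>R h) \<bullet> grad g (x + t *\<^sub>R h))) (at t)"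
      using has_derivative_compose[OF 2 1] .
    then have 3: "((\<lambda>t. g (x + t *\<^sub>R h)) has_real_derivative h \<bullet> grad g (x + t *\<^sub>R h)) (at t)"
      by (auto simp: has_field_derivative_def mult.commute elim!: has_derivative_eq_rhs)
    show ?thesis unfolding \<phi>_def
      by (rule derivative_eq_intros 3 refl | simp)+
  qed
  \<comment> \<open>Strong convexity at the points \<open>x\<close> and \<open>x + t h\<close>
    carries a common factor \<open>t\<close>, which cancels because \<open>t > 0\<close>.\<close>
  have nonneg: "h \<bullet> grad g (x + t *\<^sub>R h) - h \<bullet> grad g x - \<mu> * t * (norm h)\<^sup>2 \<ge> 0" if "t > 0" for t
  proof -
    have "(t *\<^sub>R h) \<bullet> (grad g (x + t *\<^sub>R h) - grad g x) \<ge> \<mu> * (norm (t *\<^sub>R h))\<^sup>2"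
      using assms unfolding strongly_convex_def
      by (metis add_diff_cancel_left' norm_minus_commute)
    then have "t * (h \<bullet> (grad g (x + t *\<^sub>R h) - grad g x)) \<ge> t * (\<mu> * t * (norm h)\<^sup>2)"
      by (simp add: power2_eq_square mult_ac)
    then show ?thesis using that by (simp add: inner_diff_right)
  qed
  have "\<exists>y. DERIV \<phi> t :> y \<and> 0 \<le> y" if "0 < t" "t < 1" for t
    using deriv nonneg that by blast
  moreover have "continuous_on {0..1} \<phi>"
    using deriv by (meson DERIV_continuous continuous_at_imp_continuous_on)
  ultimately have "\<phi> 0 \<le> \<phi> 1"
    by (intro DERIV_nonneg_imp_increasing_open[of 0 1 \<phi>]) auto
  then show ?thesis by (simp add: \<phi>_def h_def)
qed

text \<open>Quadratic growth makes \<open>g\<close> coercive, so a minimum over a large ball is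
  global; its gradient vanishes there, and growth above the now horizontal tangent plane makes it
  the only minimizer.\<close>

lemma strongly_convex_minimizer:
  fixes g :: "'a::euclidean_space \<Rightarrow> real"
  assumes "strongly_convex \<mu> g"
  shows "\<exists>p. grad g p = 0 \<and> (\<forall>y. is_arg_min g (\<lambda>_. True) y \<longleftrightarrow> y = p)"
proof -
  have \<mu>: "\<mu> > 0" and diff: "g differentiable (at x)" for x
    using assms by (auto simp: strongly_convex_def)
  \<comment> \<open>Outside the ball of this radius the quadratic term of the lower bound at 0
    outweighs the linear one.\<close>
  define R where "R = 2 * norm (grad g 0) / \<mu>"
  have R: "R \<ge> 0" using \<mu> by (simp add: R_def)
  have far: "g 0 \<le> g y" if "norm y \<ge> R" for y
  proof -
    have "- (y \<bullet> grad g 0) \<le> norm y * norm (grad g 0)"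
      by (metis Cauchy_Schwarz_ineq2 abs_le_D2)
    also have "\<dots> = \<mu> / 2 * (norm y * R)" using \<mu> by (simp add: R_def)
    also have "\<dots> \<le> \<mu> / 2 * (norm y * norm y)"
      using that \<mu> by (intro mult_left_mono) auto
    finally show ?thesis
      using strongly_convex_lower_bound[OF assms, of 0 y] by (simp add: power2_eq_square)
  qed
  have "continuous_on (cball 0 R) g"
    using diff by (meson continuous_at_imp_continuous_on differentiable_imp_continuous_within)
  then obtain p where p: "p \<in> cball 0 R" "\<And>y. y \<in> cball 0 R \<Longrightarrow> g p \<le> g y"
    using continuous_attains_inf[of "cball 0 R" g] R by auto
  have min: "g p \<le> g y" for y
    using p(2)[of y] p(2)[of 0] far[of y] R by (cases "norm y \<le> R") force+
  have "GDERIV g p :> grad g p" by (rule gderiv_grad[OF diff])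
  then have "(\<lambda>h. h \<bullet> grad g p) = (\<lambda>h. 0)"
    unfolding gderiv_def by (rule has_derivative_local_min) (simp add: min)
  then have grad0: "grad g p = 0" by (metis inner_eq_zero_iff)
  have "g y > g p" if "y \<noteq> p" for y
    using strongly_convex_lower_bound[OF assms, of p y] grad0 \<mu> that
    by (smt (verit) inner_zero_right mult_pos_pos zero_less_norm_iff zero_less_power
        right_minus_eq half_gt_zero_iff)
  then have "is_arg_min g (\<lambda>_. True) y \<longleftrightarrow> y = p" for y
    using min by (metis (full_types) is_arg_min_linorder leD)
  with grad0 show ?thesis by blast
qed

subsection \<open>The left null vector of the Laplacian\<close>

lemma vector_matrix_laplacian:
  "(r v* laplacian A) $ j = r $ j * (\<Sum>k\<in>UNIV. A $ j $ k) - (\<Sum>i\<in>UNIV. r $ i * A $ i $ j)"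
proof -
  have "(r v* laplacian A) $ j =
      (\<Sum>i\<in>UNIV. (if i = j then r $ i * (\<Sum>k\<in>UNIV. A $ i $ k) else 0) - r $ i * A $ i $ j)"
    unfolding vector_matrix_mult_def laplacian_def
    by (auto intro!: sum.cong simp: algebra_simps)
  then show ?thesis by (simp add: sum_subtractf)
qed

text \<open>Reads the null equation as a balance: in the matrix with entries
  \<open>r $ i * A $ i $ j\<close>, column sum and row sum agree at every node. The weights r thus
  balance a digraph that need not be balanced itself.\<close>

lemma left_null_iff:
  "r v* laplacian A = 0 \<longleftrightarrow>
     (\<forall>j. (\<Sum>i\<in>UNIV. r $ i * A $ i $ j) = r $ j * (\<Sum>k\<in>UNIV. A $ j $ k))"
  by (auto simp: vec_eq_iff vector_matrix_laplacian)

text \<open>Column by column the triangle inequality gives one inequality; summing over all columns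
  shows that none of them is strict.\<close>

lemma left_null_abs:
  assumes A: "weighted_digraph A" and r: "r v* laplacian A = 0"
  shows "(\<chi> i. \<bar>r $ i\<bar>) v* laplacian A = 0"
proof -
  have nonneg: "A $ i $ j \<ge> 0" for i j using A by (simp add: weighted_digraph_def)
  let ?d = "\<lambda>j. \<Sum>k\<in>UNIV. A $ j $ k"
  have d: "?d j \<ge> 0" for j by (simp add: nonneg sum_nonneg)
  have le: "\<bar>r $ j\<bar> * ?d j \<le> (\<Sum>i\<in>UNIV. \<bar>r $ i\<bar> * A $ i $ j)" for j
  proof -
    have "\<bar>r $ j\<bar> * ?d j = \<bar>\<Sum>i\<in>UNIV. r $ i * A $ i $ j\<bar>"
      using r d[of j] by (simp add: left_null_iff abs_mult)
    also have "\<dots> \<le> (\<Sum>i\<in>UNIV. \<bar>r $ i * A $ i $ j\<bar>)" by (rule sum_abs)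
    finally show ?thesis by (simp add: abs_mult nonneg)
  qed
  have "(\<Sum>j\<in>UNIV. \<Sum>i\<in>UNIV. \<bar>r $ i\<bar> * A $ i $ j) = (\<Sum>j\<in>UNIV. \<bar>r $ j\<bar> * ?d j)"
    by (subst sum.swap) (simp add: sum_distrib_left)
  then have "\<bar>r $ j\<bar> * ?d j = (\<Sum>i\<in>UNIV. \<bar>r $ i\<bar> * A $ i $ j)" for j
    by (intro sum_mono_inv[where I = UNIV, OF _ le]) simp_all
  then show ?thesis by (simp add: left_null_iff)
qed

text \<open>A zero spreads along edges: at a node \<open>j\<close> with \<open>r $ j = 0\<close> the
  balance equates a sum of nonnegative terms to 0, so \<open>r\<close> vanishes at the head of every
  edge leaving \<open>j\<close>. Strong connectivity carries this to all nodes.\<close>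

lemma left_null_nonneg_eq_0:
  assumes A: "weighted_digraph A" "strongly_connected A" and r: "r v* laplacian A = 0"
    and nonneg: "\<And>i. r $ i \<ge> 0" and k: "r $ k = 0"
  shows "r = 0"
proof -
  have step: "r $ i = 0" if "(j, i) \<in> edges A" "r $ j = 0" for i j
  proof -
    have "(\<Sum>i\<in>UNIV. r $ i * A $ i $ j) = 0" using r that by (simp add: left_null_iff)
    then have "r $ i * A $ i $ j = 0"
      using A nonneg by (subst (asm) sum_nonneg_eq_0_iff) (auto simp: weighted_digraph_def)
    then show ?thesis using that by (simp add: edges_def)
  qed
  have "r $ i = 0" if "(k, i) \<in> (edges A)\<^sup>+" for i
    using that by (induction rule: trancl_induct) (use step k in blast)+
  then show ?thesis
    using A(2) k unfolding strongly_connected_def vec_eq_iff by (metis zero_index)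
qed

text \<open>The Laplacian annihilates the all-ones vector, so it is singular and also has a nonzero
  left null vector. Taking absolute values keeps it null, a zero entry would make it vanish
  altogether, and dividing by the sum normalizes it.\<close>

lemma left_null_vector_exists:
  fixes A :: "real ^ 'n::finite ^ 'n"
  assumes A: "weighted_digraph A" "strongly_connected A"
  shows "\<exists>r. (\<forall>i. r $ i > 0) \<and> r v* laplacian A = 0 \<and> 1 \<bullet> r = 1"
proof -
  have "laplacian A *v 1 = 0"
    by (simp add: vec_eq_iff matrix_vector_mult_def laplacian_def sum_subtractf)
  moreover have "(1 :: real ^ 'n) \<noteq> 0" by (simp add: vec_eq_iff)
  ultimately have "\<not> invertible (laplacian A)"
    by (metis matrix_left_invertible_ker invertible_left_inverse)
  then have "\<not> (\<exists>B. B ** transpose (laplacian A) = mat 1)"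
    by (metis invertible_left_inverse transpose_invertible transpose_transpose)
  then obtain q where q: "q \<noteq> 0" "q v* laplacian A = 0"
    unfolding matrix_left_invertible_ker by (auto simp: transpose_matrix_vector)
  define s where "s = (\<chi> i. \<bar>q $ i\<bar>)"
  have s: "s v* laplacian A = 0" "s \<noteq> 0" "\<And>i. s $ i \<ge> 0"
    using left_null_abs[OF A(1) q(2)] q(1) by (auto simp: s_def vec_eq_iff)
  then have pos: "s $ i > 0" for i
    using left_null_nonneg_eq_0[OF A s(1) s(3)] by (metis order_le_less)
  define c where "c = (\<Sum>i\<in>UNIV. s $ i)"
  have c: "c > 0" unfolding c_def using pos by (intro sum_pos) auto
  show ?thesis
  proof (intro exI conjI allI)
    show "((1 / c) *\<^sub>R s) $ i > 0" for i using pos c by simp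
    show "((1 / c) *\<^sub>R s) v* laplacian A = 0"
      using s(1) by (simp add: scaleR_vector_matrix_assoc)
    show "1 \<bullet> ((1 / c) *\<^sub>R s) = 1"
      using c by (simp add: inner_vec_def c_def flip: sum_divide_distrib)
  qed
qed

text \<open>A nonzero null vector d of total mass 0 would have entries of both signs, so that
  \<open>\<bar>d\<bar> + d\<close> would be a nonnegative null vector that vanishes somewhere but not everywhere.\<close>

lemma left_null_sum_eq_0:
  fixes d :: "real ^ 'n::finite"
  assumes A: "weighted_digraph A" "strongly_connected A"
    and d: "d v* laplacian A = 0" and sum0: "1 \<bullet> d = 0"
  shows "d = 0"
proof (rule ccontr)
  assume "d \<noteq> 0"
  have sum: "(\<Sum>i\<in>UNIV. d $ i) = 0" using sum0 by (simp add: inner_vec_def)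
  define s where "s = (\<chi> i. \<bar>d $ i\<bar>) + d"
  have s: "s v* laplacian A = 0" "\<And>i. s $ i \<ge> 0"
    using left_null_abs[OF A(1) d] d by (auto simp: s_def vector_matrix_left_distrib)
  have "\<exists>k. d $ k < 0"
  proof (rule ccontr)
    assume "\<nexists>k. d $ k < 0"
    then have "\<forall>i\<in>UNIV. d $ i = 0"
      using sum by (subst (asm) sum_nonneg_eq_0_iff) (auto simp: not_less)
    with \<open>d \<noteq> 0\<close> show False by (simp add: vec_eq_iff)
  qed
  then obtain k where "d $ k < 0" by blast
  then have "s = 0" using left_null_nonneg_eq_0[OF A s, of k] by (simp add: s_def)
  then have le: "- d $ i \<ge> 0" for i
    by (simp add: s_def vec_eq_iff) (smt (verit))
  have "(\<Sum>i\<in>UNIV. - d $ i) = 0" using sum by (simp add: sum_negf)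
  then have "\<forall>i\<in>UNIV. - d $ i = 0" using le by (subst (asm) sum_nonneg_eq_0_iff) auto
  with \<open>d $ k < 0\<close> show False by auto
qed

lemma left_null_vector:
  fixes A :: "real ^ 'n::finite ^ 'n"
  assumes "weighted_digraph A" "strongly_connected A"
  shows "left_null_vector A $ i > 0" "left_null_vector A v* laplacian A = 0"
    "(\<Sum>i\<in>UNIV. left_null_vector A $ i) = 1"
proof -
  let ?P = "\<lambda>r. (\<forall>i. r $ i > 0) \<and> r v* laplacian A = 0 \<and> 1 \<bullet> r = 1"
  have "\<exists>!r. ?P r"
  proof (rule ex_ex1I)
    show "\<exists>r. ?P r" by (rule left_null_vector_exists[OF assms])
    \<comment> \<open>The difference of two candidates is a null vector of total mass 0.\<close>
    show "r = s" if "?P r" "?P s" for r s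
      using left_null_sum_eq_0[OF assms, of "r - s"] that
      by (simp add: inner_diff_right vector_matrix_mult_diff_distrib)
  qed
  from theI'[OF this] show "left_null_vector A $ i > 0" "left_null_vector A v* laplacian A = 0"
    "(\<Sum>i\<in>UNIV. left_null_vector A $ i) = 1"
    by (auto simp: left_null_vector_def inner_vec_def)
qed

subsection \<open>Dissipation by the graph Laplacian\<close>

lemma norm_sq_vec: "(norm (y :: 'a::real_normed_vector ^ 'n::finite))\<^sup>2 = (\<Sum>i\<in>UNIV. (norm (y $ i))\<^sup>2)"
  by (simp add: norm_vec_def L2_set_def sum_nonneg)

text \<open>The stacked Laplacian acting on vectors of blocks, with blocks in an arbitrary vector
  space; \<open>unstack_stacked_laplacian\<close> identifies the two. The difference form makes it
  evident that consensus vectors are annihilated.\<close>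

definition graph_lap :: "real ^ 'n::finite ^ 'n \<Rightarrow> 'a::real_vector ^ 'n \<Rightarrow> 'a ^ 'n" where
  "graph_lap A y = (\<chi> i. \<Sum>j\<in>UNIV. A $ i $ j *\<^sub>R (y $ i - y $ j))"

definition weighted_avg :: "real ^ 'n::finite \<Rightarrow> 'a::real_vector ^ 'n \<Rightarrow> 'a" where
  "weighted_avg r y = (\<Sum>i\<in>UNIV. r $ i *\<^sub>R y $ i)"

lemma linear_graph_lap: "linear (graph_lap A)"
  by (rule linearI)
    (simp_all add: graph_lap_def vec_eq_iff scaleR_sum_right algebra_simps sum.distrib sum_subtractf)

lemma linear_weighted_avg: "linear (weighted_avg r)"
  by (rule linearI) (simp_all add: weighted_avg_def scaleR_sum_right algebra_simps sum.distrib)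

lemma graph_lap_const [simp]: "graph_lap A (\<chi> i. c) = 0"
  by (simp add: graph_lap_def vec_eq_iff)

lemma weighted_avg_const: "(\<Sum>i\<in>UNIV. r $ i) = 1 \<Longrightarrow> weighted_avg r (\<chi> i. c) = c"
  by (simp add: weighted_avg_def flip: scaleR_left.sum)

text \<open>Exchanging the sums and using the balance of the weights makes both halves of the
  Laplacian equal on average. This is what conserves the weighted average of z along the
  dynamics.\<close>

lemma weighted_avg_graph_lap:
  assumes "r v* laplacian A = 0"
  shows "weighted_avg r (graph_lap A y) = 0"
proof -
  have "weighted_avg r (graph_lap A y) =
      (\<Sum>i\<in>UNIV. \<Sum>j\<in>UNIV. (r $ i * A $ i $ j) *\<^sub>R y $ i) -
      (\<Sum>i\<in>UNIV. \<Sum>j\<in>UNIV. (r $ i * A $ i $ j) *\<^sub>R y $ j)"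
    by (simp add: weighted_avg_def graph_lap_def scaleR_sum_right scaleR_diff_right sum_subtractf)
  also have "(\<Sum>i\<in>UNIV. \<Sum>j\<in>UNIV. (r $ i * A $ i $ j) *\<^sub>R y $ j) =
      (\<Sum>j\<in>UNIV. (\<Sum>i\<in>UNIV. r $ i * A $ i $ j) *\<^sub>R y $ j)"
    by (subst sum.swap) (simp add: scaleR_left.sum)
  also have "\<dots> = (\<Sum>i\<in>UNIV. \<Sum>j\<in>UNIV. (r $ i * A $ i $ j) *\<^sub>R y $ i)"
    using assms by (simp add: left_null_iff sum_distrib_left scaleR_left.sum)
  finally show ?thesis by simp
qed

text \<open>Each product of \<open>y $ i\<close> with \<open>y $ i - y $ j\<close> is half of a
  difference of squared norms plus half of the squared distance. Since the weights are balanced, the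
  differences of squares cancel in the sum, although the digraph may be asymmetric.\<close>

lemma graph_lap_energy:
  fixes y :: "'a::real_inner ^ 'n::finite"
  assumes "r v* laplacian A = 0"
  shows "(\<Sum>i\<in>UNIV. r $ i * (y $ i \<bullet> graph_lap A y $ i)) =
    (\<Sum>i\<in>UNIV. \<Sum>j\<in>UNIV. r $ i * A $ i $ j * (norm (y $ i - y $ j))\<^sup>2) / 2"
proof -
  let ?w = "\<lambda>i j. r $ i * A $ i $ j"
  have eq: "(\<Sum>i\<in>UNIV. \<Sum>j\<in>UNIV. ?w i j * (norm (y $ j))\<^sup>2) =
      (\<Sum>i\<in>UNIV. \<Sum>j\<in>UNIV. ?w i j * (norm (y $ i))\<^sup>2)"
  proof -
    have "(\<Sum>i\<in>UNIV. \<Sum>j\<in>UNIV. ?w i j * (norm (y $ j))\<^sup>2) =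
        (\<Sum>j\<in>UNIV. (\<Sum>i\<in>UNIV. ?w i j) * (norm (y $ j))\<^sup>2)"
      by (subst sum.swap) (simp add: sum_distrib_right)
    also have "\<dots> = (\<Sum>j\<in>UNIV. r $ j * (\<Sum>k\<in>UNIV. A $ j $ k) * (norm (y $ j))\<^sup>2)"
      using assms by (simp add: left_null_iff)
    finally show ?thesis by (simp add: sum_distrib_left sum_distrib_right)
  qed
  have "(\<Sum>i\<in>UNIV. r $ i * (y $ i \<bullet> graph_lap A y $ i)) =
      (\<Sum>i\<in>UNIV. \<Sum>j\<in>UNIV. ?w i j * (y $ i \<bullet> (y $ i - y $ j)))"
    by (simp add: graph_lap_def inner_sum_right sum_distrib_left mult.assoc)
  also have "\<dots> = (\<Sum>i\<in>UNIV. \<Sum>j\<in>UNIV. ?w i j * (norm (y $ i))\<^sup>2 / 2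
      - ?w i j * (norm (y $ j))\<^sup>2 / 2 + ?w i j * (norm (y $ i - y $ j))\<^sup>2 / 2)"
    by (intro sum.cong refl)
      (simp add: power2_norm_eq_inner inner_diff_left inner_diff_right inner_commute field_simps)
  finally show ?thesis
    using eq by (simp add: sum.distrib sum_subtractf flip: sum_divide_distrib)
qed

text \<open>By \<open>graph_lap_energy\<close> the right-hand side is a sum of squares that vanishes only at consensus;
  compactness of the unit sphere of \<open>weighted_avg r y = 0\<close> makes this uniform.\<close>

lemma poincare_inequality:
  fixes A :: "real ^ 'n::finite ^ 'n"
  assumes A: "weighted_digraph A" "strongly_connected A"
    and r: "\<And>i. r $ i > 0" "r v* laplacian A = 0" "(\<Sum>i\<in>UNIV. r $ i) = 1"
  shows "\<exists>\<sigma>>0. \<forall>y :: ('a::euclidean_space) ^ 'n.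
    \<sigma> * (\<Sum>i\<in>UNIV. r $ i * (norm (y $ i - weighted_avg r y))\<^sup>2)
      \<le> (\<Sum>i\<in>UNIV. r $ i * (y $ i \<bullet> graph_lap A y $ i))"
proof -
  define Q where "Q y = (\<Sum>i\<in>UNIV. \<Sum>j\<in>UNIV. r $ i * A $ i $ j * (norm (y $ i - y $ j))\<^sup>2) / 2"
    for y :: "'a ^ 'n"
  let ?K = "sphere 0 1 \<inter> {y :: 'a ^ 'n. weighted_avg r y = 0}"
  have w: "r $ i * A $ i $ j \<ge> 0" for i j
    using A(1) r(1)[of i] by (simp add: weighted_digraph_def)
  have Q_scale: "Q (c *\<^sub>R y) = c\<^sup>2 * Q y" for c y
    by (simp add: Q_def sum_distrib_left power_mult_distrib mult_ac flip: scaleR_diff_right)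
  have Q_pos: "Q y > 0" if "y \<in> ?K" for y
  proof (rule ccontr)
    assume "\<not> Q y > 0"
    moreover have "Q y \<ge> 0" unfolding Q_def by (intro divide_nonneg_nonneg sum_nonneg mult_nonneg_nonneg w) auto
    ultimately have "(\<Sum>i\<in>UNIV. \<Sum>j\<in>UNIV. r $ i * A $ i $ j * (norm (y $ i - y $ j))\<^sup>2) = 0"
      by (simp add: Q_def)
    then have "\<forall>i\<in>UNIV. (\<Sum>j\<in>UNIV. r $ i * A $ i $ j * (norm (y $ i - y $ j))\<^sup>2) = 0"
      by (subst (asm) sum_nonneg_eq_0_iff) (auto intro!: sum_nonneg mult_nonneg_nonneg w)
    then have "r $ i * A $ i $ j * (norm (y $ i - y $ j))\<^sup>2 = 0" for i j
      using w sum_nonneg_eq_0_iff[of UNIV "\<lambda>j. r $ i * A $ i $ j * (norm (y $ i - y $ j))\<^sup>2"]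
      by auto
    \<comment> \<open>Across an edge the weight is positive, so zero energy forces equal values at
      its two ends.\<close>
    then have step: "y $ i = y $ j" if "(j, i) \<in> edges A" for i j
      using that r(1)[of i] by (force simp: edges_def)
    have path: "y $ j = y $ i" if "(j, i) \<in> (edges A)\<^sup>+" for i j
      using that by (induction rule: trancl_induct) (use step in metis)+
    have const: "y $ i = y $ j" for i j
      using A(2) path by (cases "i = j") (auto simp: strongly_connected_def)
    then have "y = (\<chi> i. y $ undefined)" by (simp add: vec_eq_iff)
    moreover have "weighted_avg r y = 0" using that by simp
    ultimately have "y = 0" using weighted_avg_const[OF r(3)] by (metis vec_eq_iff vec_lambda_beta zero_index)
    then show False using that by simp
  qed
  have "\<exists>\<sigma>>0. \<forall>y. weighted_avg r y = 0 \<longrightarrow> \<sigma> * (norm y)\<^sup>2 \<le> Q y"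
  proof (cases "?K = {}")
    \<comment> \<open>The sphere does not meet the subspace when 0 is the only vector with average
      0, as for a single node; any constant then works.\<close>
    case True
    have "y = 0" if "weighted_avg r y = 0" for y :: "'a ^ 'n"
    proof (rule ccontr)
      assume "y \<noteq> 0"
      then have "(1 / norm y) *\<^sub>R y \<in> ?K"
        using that by (simp add: linear_scale[OF linear_weighted_avg])
      with True show False by blast
    qed
    moreover have "Q 0 = 0" by (simp add: Q_def)
    ultimately have "1 * (norm y)\<^sup>2 \<le> Q y" if "weighted_avg r y = 0" for y
      using that by (metis norm_zero mult_zero_right power_zero_numeral order_refl)
    then show ?thesis using zero_less_one by blast
  next
    case False
    have "closed {y :: 'a ^ 'n. weighted_avg r y = 0}"
      by (intro closed_Collect_eq continuous_intros linear_continuous_on linear_conv_bounded_linear[THEN iffD1, OF linear_weighted_avg])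
    then have "compact ?K" by (intro compact_Int_closed) auto
    moreover have "continuous_on ?K Q" unfolding Q_def by (intro continuous_intros) auto
    ultimately obtain m where m: "m \<in> ?K" "\<And>y. y \<in> ?K \<Longrightarrow> Q m \<le> Q y"
      using continuous_attains_inf[OF _ False] by blast
    \<comment> \<open>\<open>Q\<close> is homogeneous of degree 2, so its minimum on the sphere
      gives the bound on the whole subspace.\<close>
    have "Q m * (norm y)\<^sup>2 \<le> Q y" if "weighted_avg r y = 0" for y
    proof (cases "y = 0")
      case True then show ?thesis by (simp add: Q_def)
    next
      case False
      then have "(1 / norm y) *\<^sub>R y \<in> ?K"
        using that by (simp add: linear_scale[OF linear_weighted_avg])
      then have "Q m \<le> Q ((1 / norm y) *\<^sub>R y)" by (rule m(2))
      then have "Q m \<le> Q y / (norm y)\<^sup>2" by (simp add: Q_scale power_divide)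
      then show ?thesis using False by (simp add: field_simps)
    qed
    then show ?thesis using Q_pos[OF m(1)] by blast
  qed
  then obtain \<sigma> where \<sigma>: "\<sigma> > 0" "\<And>y. weighted_avg r y = 0 \<Longrightarrow> \<sigma> * (norm y)\<^sup>2 \<le> Q y" by blast
  \<comment> \<open>Lets the Euclidean norm dominate the r-weighted one, so the constant found for
    the former also serves the latter.\<close>
  have "r $ i \<le> 1" for i
    using member_le_sum[of i UNIV "($) r"] r(1,3) by (simp add: less_imp_le)
  have "\<sigma> * (\<Sum>i\<in>UNIV. r $ i * (norm (y $ i - weighted_avg r y))\<^sup>2)
      \<le> (\<Sum>i\<in>UNIV. r $ i * (y $ i \<bullet> graph_lap A y $ i))" for y :: "'a ^ 'n"
  proof -
    define v where "v = y - (\<chi> i. weighted_avg r y)"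
    have "(\<Sum>i\<in>UNIV. r $ i * (norm (v $ i))\<^sup>2) \<le> (\<Sum>i\<in>UNIV. (norm (v $ i))\<^sup>2)"
      using \<open>\<And>i. r $ i \<le> 1\<close> by (intro sum_mono) (simp add: mult_left_le_one_le r(1) less_imp_le)
    also have "\<dots> = (norm v)\<^sup>2" by (simp add: norm_sq_vec)
    finally have "\<sigma> * (\<Sum>i\<in>UNIV. r $ i * (norm (v $ i))\<^sup>2) \<le> \<sigma> * (norm v)\<^sup>2"
      using \<sigma>(1) by simp
    also have "weighted_avg r v = 0"
      by (simp add: v_def linear_diff[OF linear_weighted_avg] weighted_avg_const[OF r(3)])
    then have "\<sigma> * (norm v)\<^sup>2 \<le> Q v" by (rule \<sigma>(2))
    also have "Q v = Q y" by (simp add: Q_def v_def)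
    finally show ?thesis by (simp add: Q_def v_def graph_lap_energy[OF r(2)])
  qed
  with \<sigma>(1) show ?thesis by blast
qed

text \<open>Supplies the z-part of an equilibrium with a prescribed weighted average. The Laplacian
  alone is not injective; adding the average as a constant vector gives an injective and hence
  surjective map \<open>T\<close>, and taking averages separates its two summands.\<close>

lemma graph_lap_surj:
  fixes A :: "real ^ 'n::finite ^ 'n" and w :: "'a::euclidean_space ^ 'n"
  assumes A: "weighted_digraph A" "strongly_connected A"
    and r: "\<And>i. r $ i > 0" "r v* laplacian A = 0" "(\<Sum>i\<in>UNIV. r $ i) = 1"
    and w: "weighted_avg r w = 0"
  shows "\<exists>y. graph_lap A y = w \<and> weighted_avg r y = q"
proof -
  define T where "T y = graph_lap A y + (\<chi> i. weighted_avg r y)" for y :: "'a ^ 'n"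
  have avg_T: "weighted_avg r (T y) = weighted_avg r y" for y
    by (simp add: T_def linear_add[OF linear_weighted_avg] weighted_avg_graph_lap[OF r(2)]
        weighted_avg_const[OF r(3)])
  have "linear T"
    unfolding T_def
    by (rule linearI)
      (simp_all add: linear_add[OF linear_graph_lap] linear_add[OF linear_weighted_avg]
        linear_scale[OF linear_graph_lap] linear_scale[OF linear_weighted_avg] vec_eq_iff algebra_simps)
  moreover have "y = 0" if "T y = 0" for y
  proof -
    have avg: "weighted_avg r y = 0"
      using avg_T[of y] that linear_0[OF linear_weighted_avg] by metis
    then have lap: "graph_lap A y = 0" using that by (simp add: T_def vec_eq_iff)
    obtain \<sigma> where \<sigma>: "\<sigma> > 0" "\<sigma> * (\<Sum>i\<in>UNIV. r $ i * (norm (y $ i - weighted_avg r y))\<^sup>2)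
        \<le> (\<Sum>i\<in>UNIV. r $ i * (y $ i \<bullet> graph_lap A y $ i))"
      using poincare_inequality[OF A r, where 'a = 'a] by blast
    then have "\<sigma> * (\<Sum>i\<in>UNIV. r $ i * (norm (y $ i))\<^sup>2) \<le> 0"
      by (simp add: avg lap)
    moreover have "(\<Sum>i\<in>UNIV. r $ i * (norm (y $ i))\<^sup>2) \<ge> 0"
      using r(1) by (intro sum_nonneg) (simp add: less_imp_le)
    ultimately have "(\<Sum>i\<in>UNIV. r $ i * (norm (y $ i))\<^sup>2) = 0"
      using \<sigma>(1) by (smt (verit) mult_pos_pos)
    then have "\<forall>i\<in>UNIV. r $ i * (norm (y $ i))\<^sup>2 = 0"
      using r(1) by (subst (asm) sum_nonneg_eq_0_iff) (auto simp: less_imp_le)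
    then have "y $ i = 0" for i
      by (metis UNIV_I mult_eq_0_iff norm_eq_zero order_less_irrefl power_not_zero r(1))
    then show ?thesis by (simp add: vec_eq_iff)
  qed
  ultimately have "surj T"
    by (intro linear_injective_imp_surjective) (auto simp: linear_injective_0)
  then obtain y where y: "T y = w + (\<chi> i. q)" by (metis surjD)
  have "weighted_avg r y = q"
    using avg_T[of y] y w
    by (simp add: linear_add[OF linear_weighted_avg] weighted_avg_const[OF r(3)])
  with y show ?thesis by (auto simp: T_def)
qed

section \<open>Energy estimate in the decoupled coordinates\<close>

text \<open>The decomposition of a second moment into squared mean and variance, for the probability
  weights \<open>r\<close>.\<close>

lemma sum_weighted_norm_split:
  fixes y :: "'a::real_inner ^ 'n::finite"
  assumes "(\<Sum>i\<in>UNIV. r $ i) = 1"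
  shows "(\<Sum>i\<in>UNIV. r $ i * (norm (y $ i))\<^sup>2) =
    (norm (weighted_avg r y))\<^sup>2 + (\<Sum>i\<in>UNIV. r $ i * (norm (y $ i - weighted_avg r y))\<^sup>2)"
proof -
  let ?e = "weighted_avg r y"
  have "r $ i * (norm (y $ i))\<^sup>2 =
      2 * (?e \<bullet> (r $ i *\<^sub>R y $ i)) - r $ i * (norm ?e)\<^sup>2 + r $ i * (norm (y $ i - ?e))\<^sup>2" for i
    by (simp add: power2_norm_eq_inner inner_diff_left inner_diff_right inner_commute algebra_simps)
  then have "(\<Sum>i\<in>UNIV. r $ i * (norm (y $ i))\<^sup>2) =
      2 * (?e \<bullet> (\<Sum>i\<in>UNIV. r $ i *\<^sub>R y $ i)) - (\<Sum>i\<in>UNIV. r $ i) * (norm ?e)\<^sup>2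
        + (\<Sum>i\<in>UNIV. r $ i * (norm (y $ i - ?e))\<^sup>2)"
    by (simp add: sum.distrib sum_subtractf inner_sum_right sum_distrib_left sum_distrib_right)
  then show ?thesis
    using assms by (simp add: power2_norm_eq_inner flip: weighted_avg_def)
qed

text \<open>Compares the gradient term at \<open>x\<close> with its value at the common average
  \<open>e\<close>. The Lipschitz bound controls the difference by the disagreement of
  \<open>u\<close> and \<open>v\<close> from \<open>e\<close>; products of \<open>norm e\<close>
  with the disagreement are split with the free parameter \<nu>.\<close>

lemma node_dissipation:
  fixes h :: "'a::real_inner \<Rightarrow> 'a"
  assumes lip: "\<And>x y. norm (h x - h y) \<le> l * norm (x - y)" and h0: "h 0 = 0" and l: "l \<ge> 0"
    and ab: "0 < b" "b < a" and \<nu>: "\<nu> > 0"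
    and K: "K = a / (a - b)" and x: "x = (1 / (a - b)) *\<^sub>R (a *\<^sub>R u - b *\<^sub>R v)"
  shows "(u + v) \<bullet> h x \<ge> 2 * (e \<bullet> h e) - \<nu> * (norm e)\<^sup>2
    - 2 * ((2 * K + 1)\<^sup>2 * l\<^sup>2 / (4 * \<nu>) + K * l) * ((norm (u - e))\<^sup>2 + (norm (v - e))\<^sup>2)"
proof -
  define s where "s = norm (u - e) + norm (v - e)"
  \<comment> \<open>Collects the coefficients of \<open>norm e * s\<close>: \<open>2 * K * l\<close>
    from replacing \<open>h x\<close> by \<open>h e\<close>, and \<open>l\<close> from replacing
    \<open>u + v\<close> by twice \<open>e\<close>.\<close>
  define k where "k = (2 * K + 1) * l"
  have s: "s \<ge> 0" by (simp add: s_def)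
  have K0: "K \<ge> 0" using ab by (simp add: K)
  \<comment> \<open>The coefficients \<open>a / (a - b)\<close> and \<open>- b / (a - b)\<close> add
    up to 1, so \<open>e\<close> may be subtracted from both variables.\<close>
  have "x - e = (1 / (a - b)) *\<^sub>R (a *\<^sub>R (u - e) - b *\<^sub>R (v - e))"
  proof -
    have "e = (1 / (a - b)) *\<^sub>R ((a - b) *\<^sub>R e)" using ab by simp
    then have "x - e = (1 / (a - b)) *\<^sub>R (a *\<^sub>R u - b *\<^sub>R v) - (1 / (a - b)) *\<^sub>R ((a - b) *\<^sub>R e)"
      using x by metis
    then show ?thesis by (simp add: algebra_simps)
  qed
  then have "norm (x - e) = norm (a *\<^sub>R (u - e) - b *\<^sub>R (v - e)) / (a - b)"
    using ab by simp
  also have "\<dots> \<le> (a * norm (u - e) + b * norm (v - e)) / (a - b)"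
    using ab norm_triangle_ineq4[of "a *\<^sub>R (u - e)" "b *\<^sub>R (v - e)"]
    by (intro divide_right_mono) simp_all
  also have "\<dots> \<le> (a * norm (u - e) + a * norm (v - e)) / (a - b)"
    using ab by (intro divide_right_mono add_left_mono mult_right_mono) simp_all
  finally have xe: "norm (x - e) \<le> K * s" using ab by (simp add: K s_def algebra_simps add_divide_distrib)
  have "norm (h x - h e) \<le> l * (K * s)"
    using lip[of x e] mult_left_mono[OF xe l] by linarith
  then have 1: "\<bar>e \<bullet> (h x - h e)\<bar> \<le> norm e * (l * (K * s))"
    by (meson Cauchy_Schwarz_ineq2 mult_left_mono norm_ge_zero order_trans)
  have "norm (h x) \<le> l * norm x" using lip[of x 0] h0 by simp
  also have "norm x \<le> norm e + K * s" using xe norm_triangle_ineq[of e "x - e"] by simp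
  finally have "norm (h x) \<le> l * (norm e + K * s)" using l by (simp add: mult_left_mono)
  moreover have "norm ((u - e) + (v - e)) \<le> s" unfolding s_def by (rule norm_triangle_ineq)
  ultimately have 2: "\<bar>((u - e) + (v - e)) \<bullet> h x\<bar> \<le> s * (l * (norm e + K * s))"
    by (meson Cauchy_Schwarz_ineq2 mult_mono norm_ge_zero order_trans s)
  have "(u + v) \<bullet> h x = 2 * (e \<bullet> h e) + 2 * (e \<bullet> (h x - h e)) + ((u - e) + (v - e)) \<bullet> h x"
    by (simp add: algebra_simps inner_commute)
  also have "\<dots> \<ge> 2 * (e \<bullet> h e) - 2 * (norm e * (l * (K * s))) - s * (l * (norm e + K * s))"
    using 1 2 by linarith
  also have "2 * (e \<bullet> h e) - 2 * (norm e * (l * (K * s))) - s * (l * (norm e + K * s))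
      = 2 * (e \<bullet> h e) - k * norm e * s - K * l * s\<^sup>2"
    by (simp add: k_def power2_eq_square algebra_simps)
  finally have main: "(u + v) \<bullet> h x \<ge> 2 * (e \<bullet> h e) - k * norm e * s - K * l * s\<^sup>2" .
  \<comment> \<open>Young's inequality, by completing the square.\<close>
  have "0 \<le> (\<nu> * norm e - k * s / 2)\<^sup>2 / \<nu>" using \<nu> by simp
  also have "\<dots> = \<nu> * (norm e)\<^sup>2 - k * norm e * s + k\<^sup>2 / (4 * \<nu>) * s\<^sup>2"
    using \<nu> by (simp add: power2_eq_square field_simps)
  finally have "(u + v) \<bullet> h x \<ge> 2 * (e \<bullet> h e) - \<nu> * (norm e)\<^sup>2 - (k\<^sup>2 / (4 * \<nu>) + K * l) * s\<^sup>2"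
    using main by (simp add: algebra_simps)
  moreover have "s\<^sup>2 \<le> 2 * ((norm (u - e))\<^sup>2 + (norm (v - e))\<^sup>2)"
    unfolding s_def 
    using sum_squares_bound[of "norm (u - e)" "norm (v - e)"] by (simp add: power2_sum)
  then have "(k\<^sup>2 / (4 * \<nu>) + K * l) * s\<^sup>2
      \<le> (k\<^sup>2 / (4 * \<nu>) + K * l) * (2 * ((norm (u - e))\<^sup>2 + (norm (v - e))\<^sup>2))"
    using \<nu> K0 l by (intro mult_left_mono) auto
  ultimately have "(u + v) \<bullet> h x \<ge> 2 * (e \<bullet> h e) - \<nu> * (norm e)\<^sup>2
      - (k\<^sup>2 / (4 * \<nu>) + K * l) * (2 * ((norm (u - e))\<^sup>2 + (norm (v - e))\<^sup>2))"
    by linarith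
  then show ?thesis by (simp only: k_def power_mult_distrib mult.assoc mult.left_commute[of 2])
qed

text \<open>Only the sum of the terms in \<open>h i\<close> is monotone, so strong convexity
  contributes solely through the average \<open>e\<close>; the Laplacian contributes the
  disagreement \<open>D\<close>. The value of \<nu> makes the losses of all nodes add up to half of
  the strong convexity gain, and the bound on \<gamma> lets the cross terms consume half of the
  Laplacian gain.\<close>

lemma dissipation:
  fixes U V :: "'a::real_inner ^ 'n::finite" and h :: "'n \<Rightarrow> 'a \<Rightarrow> 'a"
  assumes lip: "\<And>i x y. norm (h i x - h i y) \<le> l i * norm (x - y)"
    and h0: "\<And>i. h i 0 = 0" and l: "\<And>i. l i \<ge> 0"
    and mono: "\<And>e. (\<Sum>i\<in>UNIV. e \<bullet> h i e) \<ge> \<mu> * (norm e)\<^sup>2" and \<mu>: "\<mu> > 0"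
    and ab: "0 < b" "b < a"
    and r: "\<And>i. r $ i > 0" "(\<Sum>i\<in>UNIV. r $ i) = 1"
    and \<sigma>: "\<sigma> > 0" "\<And>y :: 'a ^ 'n. \<sigma> * (\<Sum>i\<in>UNIV. r $ i * (norm (y $ i - weighted_avg r y))\<^sup>2)
        \<le> (\<Sum>i\<in>UNIV. r $ i * (y $ i \<bullet> graph_lap A y $ i))"
    and avg: "weighted_avg r U = weighted_avg r V"
    and K: "K = a / (a - b)" and \<nu>: "\<nu> = \<mu> / CARD('n)"
    and \<gamma>: "\<gamma> > 0" "\<And>i. \<gamma> * ((2 * K + 1)\<^sup>2 * (l i)\<^sup>2 / (4 * \<nu>) + K * l i) \<le> b * \<sigma> * r $ i / 4"
    and X: "\<And>i. X $ i = (1 / (a - b)) *\<^sub>R (a *\<^sub>R U $ i - b *\<^sub>R V $ i)"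
  shows "- 2 * \<gamma> * (\<Sum>i\<in>UNIV. (U $ i + V $ i) \<bullet> h i (X $ i))
      - 2 * a * (\<Sum>i\<in>UNIV. r $ i * (U $ i \<bullet> graph_lap A U $ i))
      - 2 * b * (\<Sum>i\<in>UNIV. r $ i * (V $ i \<bullet> graph_lap A V $ i))
    \<le> - (min (\<gamma> * \<mu>) (b * \<sigma>)) * (\<Sum>i\<in>UNIV. r $ i * ((norm (U $ i))\<^sup>2 + (norm (V $ i))\<^sup>2))"
proof -
  define e where "e = weighted_avg r U"
  define D where "D = (\<Sum>i\<in>UNIV. r $ i * ((norm (U $ i - e))\<^sup>2 + (norm (V $ i - e))\<^sup>2))"
  define c where "c i = (2 * K + 1)\<^sup>2 * (l i)\<^sup>2 / (4 * \<nu>) + K * l i" for i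
  have \<nu>0: "\<nu> > 0" using \<mu> by (simp add: \<nu>)
  have D_split: "D = (\<Sum>i\<in>UNIV. r $ i * (norm (U $ i - e))\<^sup>2) + (\<Sum>i\<in>UNIV. r $ i * (norm (V $ i - e))\<^sup>2)"
    by (simp add: D_def ring_distribs sum.distrib)
  have D0: "D \<ge> 0" unfolding D_def using r(1) by (intro sum_nonneg mult_nonneg_nonneg) (auto simp: less_imp_le)
  have "(\<Sum>i\<in>UNIV. 2 * (e \<bullet> h i e) - \<nu> * (norm e)\<^sup>2
      - 2 * c i * ((norm (U $ i - e))\<^sup>2 + (norm (V $ i - e))\<^sup>2))
    \<le> (\<Sum>i\<in>UNIV. (U $ i + V $ i) \<bullet> h i (X $ i))"
    unfolding c_def by (intro sum_mono node_dissipation[OF lip h0 l ab \<nu>0 K X])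
  then have "\<gamma> * (\<Sum>i\<in>UNIV. (U $ i + V $ i) \<bullet> h i (X $ i)) \<ge>
      \<gamma> * (2 * (\<Sum>i\<in>UNIV. e \<bullet> h i e) - \<mu> * (norm e)\<^sup>2)
      - 2 * (\<Sum>i\<in>UNIV. (\<gamma> * c i) * ((norm (U $ i - e))\<^sup>2 + (norm (V $ i - e))\<^sup>2))"
    using mult_left_mono[OF _ less_imp_le[OF \<gamma>(1)]]
    by (fastforce simp: sum.distrib sum_subtractf sum_distrib_left \<nu> algebra_simps)
  moreover have "(\<Sum>i\<in>UNIV. (\<gamma> * c i) * ((norm (U $ i - e))\<^sup>2 + (norm (V $ i - e))\<^sup>2))
      \<le> (\<Sum>i\<in>UNIV. (b * \<sigma> * r $ i / 4) * ((norm (U $ i - e))\<^sup>2 + (norm (V $ i - e))\<^sup>2))"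
    using \<gamma>(2) unfolding c_def by (intro sum_mono mult_right_mono) auto
  moreover have "\<dots> = b * \<sigma> / 4 * D"
    by (simp add: D_def sum_distrib_left mult.assoc)
  moreover have "\<gamma> * (2 * (\<Sum>i\<in>UNIV. e \<bullet> h i e) - \<mu> * (norm e)\<^sup>2) \<ge> \<gamma> * (\<mu> * (norm e)\<^sup>2)"
    using mono[of e] \<gamma>(1) by (intro mult_left_mono) auto
  ultimately have 1: "- 2 * \<gamma> * (\<Sum>i\<in>UNIV. (U $ i + V $ i) \<bullet> h i (X $ i))
      \<le> - 2 * (\<gamma> * \<mu> * (norm e)\<^sup>2) + b * \<sigma> * D"
    by (simp add: algebra_simps)
  have "b * (\<sigma> * (\<Sum>i\<in>UNIV. r $ i * (norm (V $ i - e))\<^sup>2))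
      \<le> b * (\<Sum>i\<in>UNIV. r $ i * (V $ i \<bullet> graph_lap A V $ i))"
    using \<sigma>(2)[of V] avg ab by (intro mult_left_mono) (auto simp: e_def)
  \<comment> \<open>The larger rate \<open>a\<close> is weakened to \<open>b\<close>, so that both
    variables dissipate at the same rate.\<close>
  moreover have "b * (\<sigma> * (\<Sum>i\<in>UNIV. r $ i * (norm (U $ i - e))\<^sup>2))
      \<le> a * (\<Sum>i\<in>UNIV. r $ i * (U $ i \<bullet> graph_lap A U $ i))"
  proof (rule mult_mono)
    show "\<sigma> * (\<Sum>i\<in>UNIV. r $ i * (norm (U $ i - e))\<^sup>2) \<le> (\<Sum>i\<in>UNIV. r $ i * (U $ i \<bullet> graph_lap A U $ i))"
      using \<sigma>(2)[of U] by (simp add: e_def)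
    show "0 \<le> \<sigma> * (\<Sum>i\<in>UNIV. r $ i * (norm (U $ i - e))\<^sup>2)"
      using \<sigma>(1) r(1) by (intro mult_nonneg_nonneg sum_nonneg) (auto simp: less_imp_le)
  qed (use ab in auto)
  ultimately have 2: "- 2 * a * (\<Sum>i\<in>UNIV. r $ i * (U $ i \<bullet> graph_lap A U $ i))
      - 2 * b * (\<Sum>i\<in>UNIV. r $ i * (V $ i \<bullet> graph_lap A V $ i)) \<le> - 2 * (b * \<sigma> * D)"
    unfolding D_split by (simp add: algebra_simps)
  \<comment> \<open>The average counts twice because \<open>U\<close> and \<open>V\<close> share
    it.\<close>
  have "(\<Sum>i\<in>UNIV. r $ i * ((norm (U $ i))\<^sup>2 + (norm (V $ i))\<^sup>2)) = 2 * (norm e)\<^sup>2 + D"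
    using sum_weighted_norm_split[OF r(2), of U] sum_weighted_norm_split[OF r(2), of V] avg
    by (simp add: ring_distribs sum.distrib D_split e_def)
  moreover have "min (\<gamma> * \<mu>) (b * \<sigma>) * (2 * (norm e)\<^sup>2 + D) \<le> \<gamma> * \<mu> * (2 * (norm e)\<^sup>2) + b * \<sigma> * D"
    unfolding ring_distribs using D0 by (intro add_mono mult_right_mono) auto
  ultimately show ?thesis using 1 2 by simp
qed

subsection \<open>Exponential stability of the error system\<close>

text \<open>Gronwall's argument: after multiplication by the growing exponential the function is
  nonincreasing.\<close>

lemma exponential_decay:
  fixes S S' :: "real \<Rightarrow> real"
  assumes deriv: "\<And>t. t \<ge> 0 \<Longrightarrow> (S has_real_derivative S' t) (at t within {0..})"
    and le: "\<And>t. t \<ge> 0 \<Longrightarrow> S' t \<le> - c * S t" and t: "t \<ge> 0"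
  shows "S t \<le> S 0 * exp (- c * t)"
proof -
  define G where "G s = S s * exp (c * s)" for s
  have G: "(G has_real_derivative (S' s + c * S s) * exp (c * s)) (at s within {0..})"
    if "s \<ge> 0" for s
    unfolding G_def by (rule derivative_eq_intros deriv[OF that] refl | simp add: algebra_simps)+
  have "G t \<le> G 0"
  proof (rule DERIV_nonpos_imp_decreasing_open[OF t])
    fix s assume s: "0 < s" "s < t"
    \<comment> \<open>At interior times the derivative relative to the half-line is the ordinary
      one.\<close>
    have "at s within {0..} = at s" using s by (intro at_within_interior) auto
    then have "(G has_real_derivative (S' s + c * S s) * exp (c * s)) (at s)"
      using G[of s] s by simp
    moreover have "(S' s + c * S s) * exp (c * s) \<le> 0"
      using le[of s] s by (intro mult_nonpos_nonneg) auto
    ultimately show "\<exists>y. (G has_real_derivative y) (at s) \<and> y \<le> 0" by blast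
  next
    have "continuous_on {0..} G" by (rule DERIV_continuous_on) (use G in auto)
    then show "continuous_on {0..t} G" by (rule continuous_on_subset) auto
  qed
  then show ?thesis by (simp add: G_def exp_minus field_simps)
qed

text \<open>The dynamics of the deviation from an equilibrium; \<open>h i\<close> stands for the increment of
  \<open>grad (f i)\<close> from the optimal solution.\<close>

definition error_system ::
    "real ^ 'n::finite ^ 'n \<Rightarrow> real ^ 'n \<Rightarrow> ('n \<Rightarrow> 'a::real_normed_vector \<Rightarrow> 'a) \<Rightarrow> real \<Rightarrow> real \<Rightarrow> real \<Rightarrow>
     (real \<Rightarrow> 'a ^ 'n) \<Rightarrow> (real \<Rightarrow> 'a ^ 'n) \<Rightarrow> bool" where
  "error_system A r h \<alpha> \<beta> \<gamma> X Z \<longleftrightarrow>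
     (\<forall>t\<ge>0.
        (X has_vector_derivative
           - (\<chi> i. (\<gamma> / r $ i) *\<^sub>R h i (X t $ i)) - graph_lap A (Z t) - \<alpha> *\<^sub>R graph_lap A (X t))
          (at t within {0..}) \<and>
        (Z has_vector_derivative \<beta> *\<^sub>R graph_lap A (X t)) (at t within {0..}))"

text \<open>The r-weighted squared norm of the decoupled variables is a Lyapunov function by
  \<open>dissipation\<close>; inverting the change of variables transfers its decay to
  \<open>X\<close> and \<open>Z\<close>.\<close>

lemma error_system_decay:
  fixes A :: "real ^ 'n::finite ^ 'n" and h :: "'n \<Rightarrow> 'a::euclidean_space \<Rightarrow> 'a"
  assumes lip: "\<And>i x y. norm (h i x - h i y) \<le> l i * norm (x - y)"
    and h0: "\<And>i. h i 0 = 0" and l: "\<And>i. l i \<ge> 0"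
    and mono: "\<And>e. (\<Sum>i\<in>UNIV. e \<bullet> h i e) \<ge> \<mu> * (norm e)\<^sup>2" and \<mu>: "\<mu> > 0"
    and ab: "0 < b" "b < a"
    and r: "\<And>i. r $ i > 0" "r v* laplacian A = 0" "(\<Sum>i\<in>UNIV. r $ i) = 1"
    and \<sigma>: "\<sigma> > 0" "\<And>y :: 'a ^ 'n. \<sigma> * (\<Sum>i\<in>UNIV. r $ i * (norm (y $ i - weighted_avg r y))\<^sup>2)
        \<le> (\<Sum>i\<in>UNIV. r $ i * (y $ i \<bullet> graph_lap A y $ i))"
    and K: "K = a / (a - b)" and \<nu>: "\<nu> = \<mu> / CARD('n)"
    and \<gamma>: "\<gamma> > 0" "\<And>i. \<gamma> * ((2 * K + 1)\<^sup>2 * (l i)\<^sup>2 / (4 * \<nu>) + K * l i) \<le> b * \<sigma> * r $ i / 4"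
    and sys: "error_system A r h (a + b) (a * b) \<gamma> X Z" and Z0: "weighted_avg r (Z 0) = 0"
  shows "\<exists>C>0. \<forall>t\<ge>0. norm (X t) \<le> C * exp (- (min (\<gamma> * \<mu>) (b * \<sigma>) / 2) * t) \<and>
    norm (Z t) \<le> C * exp (- (min (\<gamma> * \<mu>) (b * \<sigma>) / 2) * t)"
proof -
  define c where "c = min (\<gamma> * \<mu>) (b * \<sigma>)"
  define U where "U t = X t + (1 / a) *\<^sub>R Z t" for t
  define V where "V t = X t + (1 / b) *\<^sub>R Z t" for t
  define F where "F t = (\<chi> i. (\<gamma> / r $ i) *\<^sub>R h i (X t $ i))" for t
  have dX: "(X has_vector_derivative - F t - graph_lap A (Z t) - (a + b) *\<^sub>R graph_lap A (X t)) (at t within {0..})"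
    and dZ: "(Z has_vector_derivative (a * b) *\<^sub>R graph_lap A (X t)) (at t within {0..})"
    if "t \<ge> 0" for t
    using sys that by (auto simp: error_system_def F_def)
  \<comment> \<open>Adding \<open>1 / a\<close> times the equation of \<open>Z\<close> lowers the
    coefficient of the Laplacian of \<open>X\<close> from \<open>a + b\<close> to \<open>a\<close>,
    which completes the term in \<open>U\<close>. The same with \<open>b\<close> gives the equation
    of \<open>V\<close>.\<close>
  have dU: "(U has_vector_derivative - F t - a *\<^sub>R graph_lap A (U t)) (at t within {0..})" if "t \<ge> 0" for t
  proof -
    have "(U has_vector_derivative (- F t - graph_lap A (Z t) - (a + b) *\<^sub>R graph_lap A (X t))
        + (1 / a) *\<^sub>R ((a * b) *\<^sub>R graph_lap A (X t))) (at t within {0..})"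
      unfolding U_def
      by (intro has_vector_derivative_add dX[OF that] dZ[OF that]
          bounded_linear.has_vector_derivative[OF bounded_linear_scaleR_right])
    then show ?thesis
      using ab by (simp add: U_def linear_add[OF linear_graph_lap] linear_scale[OF linear_graph_lap] algebra_simps)
  qed
  have dV: "(V has_vector_derivative - F t - b *\<^sub>R graph_lap A (V t)) (at t within {0..})" if "t \<ge> 0" for t
  proof -
    have "(V has_vector_derivative (- F t - graph_lap A (Z t) - (a + b) *\<^sub>R graph_lap A (X t))
        + (1 / b) *\<^sub>R ((a * b) *\<^sub>R graph_lap A (X t))) (at t within {0..})"
      unfolding V_def
      by (intro has_vector_derivative_add dX[OF that] dZ[OF that]
          bounded_linear.has_vector_derivative[OF bounded_linear_scaleR_right])
    then show ?thesis
      using ab by (simp add: V_def linear_add[OF linear_graph_lap] linear_scale[OF linear_graph_lap] algebra_simps)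
  qed
  have bl: "bounded_linear (weighted_avg r :: 'a ^ 'n \<Rightarrow> 'a)"
    by (rule linear_conv_bounded_linear[THEN iffD1, OF linear_weighted_avg])
  \<comment> \<open>The average of \<open>Z\<close> is conserved and starts at 0, which is why
    \<open>U\<close> and \<open>V\<close> have equal averages at all times.\<close>
  have "((\<lambda>t. weighted_avg r (Z t)) has_vector_derivative 0) (at t within {0..})" if "t \<in> {0..}" for t
    using bounded_linear.has_vector_derivative[OF bl dZ] that
    by (simp add: linear_scale[OF linear_weighted_avg] weighted_avg_graph_lap[OF r(2)])
  then obtain k where "\<And>t. t \<in> {0..} \<Longrightarrow> weighted_avg r (Z t) = k"
    using has_vector_derivative_zero_constant[of "{0..}" "\<lambda>t. weighted_avg r (Z t)"] by force
  then have avgZ: "weighted_avg r (Z t) = 0" if "t \<ge> 0" for t using Z0 that by force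
  have avg: "weighted_avg r (U t) = weighted_avg r (V t)" if "t \<ge> 0" for t
    using avgZ[OF that]
    by (simp add: U_def V_def linear_add[OF linear_weighted_avg] linear_scale[OF linear_weighted_avg])
  have X_eq: "X t = (1 / (a - b)) *\<^sub>R (a *\<^sub>R U t - b *\<^sub>R V t)" for t
  proof -
    have "a *\<^sub>R U t - b *\<^sub>R V t = (a - b) *\<^sub>R X t"
      using ab by (simp add: U_def V_def algebra_simps)
    then show ?thesis using ab by simp
  qed
  have Z_eq: "Z t = (a * b / (a - b)) *\<^sub>R (V t - U t)" for t
  proof -
    have "V t - U t = (1 / b - 1 / a) *\<^sub>R Z t" by (simp add: U_def V_def algebra_simps)
    moreover have "a * b / (a - b) * (1 / b - 1 / a) = 1" using ab by (simp add: field_simps)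
    ultimately show ?thesis by (simp only: scaleR_scaleR scaleR_one)
  qed
  define S where "S t = (\<Sum>i\<in>UNIV. r $ i * ((norm (U t $ i))\<^sup>2 + (norm (V t $ i))\<^sup>2))" for t
  define S' where "S' t = (\<Sum>i\<in>UNIV. r $ i * (2 * (U t $ i \<bullet> (- F t - a *\<^sub>R graph_lap A (U t)) $ i)
      + 2 * (V t $ i \<bullet> (- F t - b *\<^sub>R graph_lap A (V t)) $ i)))" for t
  have sq: "((\<lambda>t. (norm (Y t $ i))\<^sup>2) has_real_derivative 2 * (Y t $ i \<bullet> Y' $ i)) (at t within {0..})"
    if "(Y has_vector_derivative Y') (at t within {0..})" for Y :: "real \<Rightarrow> 'a ^ 'n" and Y' t i
  proof -
    have "((\<lambda>t. Y t $ i) has_vector_derivative Y' $ i) (at t within {0..})"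
      by (rule bounded_linear.has_vector_derivative[OF bounded_linear_vec_nth that])
    then have *: "((\<lambda>t. Y t $ i) has_derivative (\<lambda>s. s *\<^sub>R Y' $ i)) (at t within {0..})"
      by (simp add: has_vector_derivative_def)
    show ?thesis
      using has_derivative_inner[OF * *]
      by (auto simp: power2_norm_eq_inner has_field_derivative_def inner_commute algebra_simps
          elim!: has_derivative_eq_rhs)
  qed
  have "(S has_real_derivative S' t) (at t within {0..})" if "t \<ge> 0" for t
    unfolding S_def S'_def
    by (intro DERIV_sum DERIV_cmult DERIV_add sq dU dV that)
  moreover have "S' t \<le> - c * S t" if "t \<ge> 0" for t
  proof -
    \<comment> \<open>The weight \<open>r $ i\<close> of the norm cancels the factor
      \<open>1 / r $ i\<close> of the scaled costs, so the increments of the original gradients add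
      up.\<close>
    have "r $ i * (2 * (U t $ i \<bullet> (- F t - a *\<^sub>R graph_lap A (U t)) $ i)
        + 2 * (V t $ i \<bullet> (- F t - b *\<^sub>R graph_lap A (V t)) $ i)) =
        - 2 * \<gamma> * ((U t $ i + V t $ i) \<bullet> h i (X t $ i))
        - 2 * a * (r $ i * (U t $ i \<bullet> graph_lap A (U t) $ i))
        - 2 * b * (r $ i * (V t $ i \<bullet> graph_lap A (V t) $ i))" for i
      using r(1)[of i] by (simp add: F_def field_simps inner_diff_right inner_add_left)
    then have "S' t = - 2 * \<gamma> * (\<Sum>i\<in>UNIV. (U t $ i + V t $ i) \<bullet> h i (X t $ i))
        - 2 * a * (\<Sum>i\<in>UNIV. r $ i * (U t $ i \<bullet> graph_lap A (U t) $ i))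
        - 2 * b * (\<Sum>i\<in>UNIV. r $ i * (V t $ i \<bullet> graph_lap A (V t) $ i))"
      unfolding S'_def by (simp only: sum_subtractf sum_distrib_left)
    also have "\<dots> \<le> - c * S t"
      unfolding S_def c_def
      by (rule dissipation[OF lip h0 l mono \<mu> ab r(1) r(3) \<sigma> avg[OF that] K \<nu> \<gamma>]) (simp add: X_eq)
    finally show ?thesis .
  qed
  ultimately have decay: "S t \<le> S 0 * exp (- c * t)" if "t \<ge> 0" for t
    using that by (rule exponential_decay)
  \<comment> \<open>The smallest weight converts the weighted norm back to the Euclidean
    one.\<close>
  define \<rho> where "\<rho> = Min (range (($) r))"
  have \<rho>: "\<rho> > 0" "\<And>i. \<rho> \<le> r $ i" using r(1) by (auto simp: \<rho>_def)
  define M where "M = sqrt (S 0 / \<rho>)"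
  \<comment> \<open>Half the rate, since \<open>S\<close> is quadratic in the variables.\<close>
  define E where "E t = exp (- (c / 2) * t)" for t
  have E: "E t > 0" for t by (simp add: E_def)
  have S0: "S 0 \<ge> 0"
    unfolding S_def using r(1) by (intro sum_nonneg mult_nonneg_nonneg) (auto simp: less_imp_le)
  have M: "M \<ge> 0" using S0 \<rho>(1) by (simp add: M_def)
  have bound: "norm (U t) \<le> M * E t \<and> norm (V t) \<le> M * E t" if "t \<ge> 0" for t
  proof -
    have "\<rho> * ((norm (U t))\<^sup>2 + (norm (V t))\<^sup>2) =
        (\<Sum>i\<in>UNIV. \<rho> * ((norm (U t $ i))\<^sup>2 + (norm (V t $ i))\<^sup>2))"
      by (simp add: norm_sq_vec sum_distrib_left sum.distrib ring_distribs)
    also have "\<dots> \<le> S t"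
      unfolding S_def using \<rho>(2) by (intro sum_mono mult_right_mono) auto
    also have "\<dots> \<le> S 0 * exp (- c * t)" by (rule decay[OF that])
    finally have "(norm (U t))\<^sup>2 + (norm (V t))\<^sup>2 \<le> (S 0 / \<rho>) * exp (- c * t)"
      using \<rho>(1) by (simp add: field_simps)
    also have "\<dots> = (M * E t)\<^sup>2"
      using S0 \<rho>(1)
      by (simp add: M_def E_def power_mult_distrib power2_eq_square[of "exp _"] flip: exp_add)
    finally have "(norm (U t))\<^sup>2 \<le> (M * E t)\<^sup>2" "(norm (V t))\<^sup>2 \<le> (M * E t)\<^sup>2"
      using zero_le_power2[of "norm (U t)"] zero_le_power2[of "norm (V t)"] by linarith+
    then show ?thesis using M E[of t] by (auto intro: power2_le_imp_le)
  qed
  \<comment> \<open>The summand 1 keeps the constant positive when the initial error is 0.\<close>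
  define C where "C = (a + b) / (a - b) * M + 2 * (a * b / (a - b)) * M + 1"
  have parts: "(a + b) / (a - b) * M \<ge> 0" "2 * (a * b / (a - b)) * M \<ge> 0" using ab M by auto
  have "norm (X t) \<le> C * E t \<and> norm (Z t) \<le> C * E t" if "t \<ge> 0" for t
  proof
    have "norm (X t) = norm (a *\<^sub>R U t - b *\<^sub>R V t) / (a - b)" using ab by (simp add: X_eq)
    also have "\<dots> \<le> (a * norm (U t) + b * norm (V t)) / (a - b)"
      using ab norm_triangle_ineq4[of "a *\<^sub>R U t" "b *\<^sub>R V t"] by (intro divide_right_mono) simp_all
    also have "\<dots> \<le> (a * (M * E t) + b * (M * E t)) / (a - b)"
      using ab bound[OF that] by (intro divide_right_mono add_mono mult_left_mono) simp_all
    also have "\<dots> = (a + b) / (a - b) * M * E t" by (simp add: algebra_simps)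
    also have "\<dots> \<le> C * E t" using parts E[of t] by (intro mult_right_mono) (auto simp: C_def)
    finally show "norm (X t) \<le> C * E t" .
    have "norm (Z t) = a * b / (a - b) * norm (V t - U t)" using ab by (subst Z_eq) (simp add: abs_mult)
    also have "\<dots> \<le> a * b / (a - b) * (M * E t + M * E t)"
      using ab bound[OF that] norm_triangle_ineq4[of "V t" "U t"] by (intro mult_left_mono) auto
    also have "\<dots> = 2 * (a * b / (a - b)) * M * E t" by (simp add: algebra_simps)
    also have "\<dots> \<le> C * E t" using parts E[of t] by (intro mult_right_mono) (auto simp: C_def)
    finally show "norm (Z t) \<le> C * E t" .
  qed
  moreover have "C > 0" using parts by (simp add: C_def)
  ultimately show ?thesis by (auto simp: E_def c_def)
qed

text \<open>All requirements on the gain are finitely many upper bounds, so a positive gain meets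
  them. It and the rate depend on the graph through \<sigma> and \<open>r\<close>, but not on the
  trajectory.\<close>

lemma error_system_stable:
  fixes A :: "real ^ 'n::finite ^ 'n" and h :: "'n \<Rightarrow> 'a::euclidean_space \<Rightarrow> 'a"
  assumes A: "weighted_digraph A" "strongly_connected A"
    and r: "\<And>i. r $ i > 0" "r v* laplacian A = 0" "(\<Sum>i\<in>UNIV. r $ i) = 1"
    and lip: "\<And>i x y. norm (h i x - h i y) \<le> l i * norm (x - y)"
    and h0: "\<And>i. h i 0 = 0" and l: "\<And>i. l i \<ge> 0"
    and mono: "\<And>e. (\<Sum>i\<in>UNIV. e \<bullet> h i e) \<ge> \<mu> * (norm e)\<^sup>2" and \<mu>: "\<mu> > 0"
    and gains: "\<alpha> > 0" "\<beta> > 0" "\<alpha>\<^sup>2 > 4 * \<beta>"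
  shows "\<exists>\<gamma>>0. \<exists>\<kappa>>0. \<forall>X Z. error_system A r h \<alpha> \<beta> \<gamma> X Z \<longrightarrow> weighted_avg r (Z 0) = 0 \<longrightarrow>
    (\<exists>C>0. \<forall>t\<ge>0. norm (X t) \<le> C * exp (- \<kappa> * t) \<and> norm (Z t) \<le> C * exp (- \<kappa> * t))"
proof -
  \<comment> \<open>\<open>a\<close> and \<open>b\<close> below are the roots of the quadratic with
    root sum \<alpha> and product \<beta>; its discriminant is positive by the gain
    condition.\<close>
  define d where "d = sqrt (\<alpha>\<^sup>2 - 4 * \<beta>)"
  define a where "a = (\<alpha> + d) / 2"
  define b where "b = (\<alpha> - d) / 2"
  have d: "d > 0" "d\<^sup>2 = \<alpha>\<^sup>2 - 4 * \<beta>" using gains by (simp_all add: d_def)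
  then have "d\<^sup>2 < \<alpha>\<^sup>2" using gains(2) by simp
  then have "d < \<alpha>" by (rule power2_less_imp_less) (use gains(1) in simp)
  then have ab: "0 < b" "b < a" using d by (simp_all add: a_def b_def)
  have sum_ab: "a + b = \<alpha>" by (simp add: a_def b_def field_simps)
  have "a * b = (\<alpha>\<^sup>2 - d\<^sup>2) / 4" by (simp add: a_def b_def power2_eq_square field_simps)
  then have prod_ab: "a * b = \<beta>" using d by simp
  obtain \<sigma> where \<sigma>: "\<sigma> > 0" "\<And>y :: 'a ^ 'n. \<sigma> * (\<Sum>i\<in>UNIV. r $ i * (norm (y $ i - weighted_avg r y))\<^sup>2)
      \<le> (\<Sum>i\<in>UNIV. r $ i * (y $ i \<bullet> graph_lap A y $ i))"
    using poincare_inequality[OF A r, where 'a = 'a] by blast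
  define K where "K = a / (a - b)"
  define \<nu> where "\<nu> = \<mu> / CARD('n)"
  define c where "c i = (2 * K + 1)\<^sup>2 * (l i)\<^sup>2 / (4 * \<nu>) + K * l i" for i
  have c: "c i \<ge> 0" for i using \<mu> l[of i] ab by (simp add: c_def K_def \<nu>_def)
  \<comment> \<open>The added 1 avoids division by 0 at nodes whose Lipschitz constant is 0.\<close>
  define \<gamma> where "\<gamma> = Min (range (\<lambda>i. b * \<sigma> * r $ i / 4 / (c i + 1)))"
  have pos: "b * \<sigma> * r $ i / 4 / (c i + 1) > 0" for i
    using ab \<sigma>(1) r(1)[of i] c[of i] by (intro divide_pos_pos mult_pos_pos) auto
  then have \<gamma>: "\<gamma> > 0" by (auto simp: \<gamma>_def)
  have small: "\<gamma> * c i \<le> b * \<sigma> * r $ i / 4" for i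
  proof -
    have "\<gamma> \<le> b * \<sigma> * r $ i / 4 / (c i + 1)" by (simp add: \<gamma>_def)
    then have "\<gamma> * (c i + 1) \<le> b * \<sigma> * r $ i / 4" using c[of i] by (subst (asm) pos_le_divide_eq) auto
    then show ?thesis using \<gamma> by (simp add: algebra_simps)
  qed
  have "\<exists>C>0. \<forall>t\<ge>0. norm (X t) \<le> C * exp (- (min (\<gamma> * \<mu>) (b * \<sigma>) / 2) * t) \<and>
      norm (Z t) \<le> C * exp (- (min (\<gamma> * \<mu>) (b * \<sigma>) / 2) * t)"
    if "error_system A r h \<alpha> \<beta> \<gamma> X Z" "weighted_avg r (Z 0) = 0" for X Z
    using error_system_decay[OF lip h0 l mono \<mu> ab r \<sigma> K_def \<nu>_def \<gamma>] small that
    unfolding c_def sum_ab prod_ab by blast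
  moreover have "min (\<gamma> * \<mu>) (b * \<sigma>) / 2 > 0" using \<gamma> \<mu> ab \<sigma>(1) by simp
  ultimately show ?thesis using \<gamma> by blast
qed

subsection \<open>Stacked vectors\<close>

text \<open>A linear isometry from the flat index set of pairs to vectors of blocks, on which the
  graph operators above act.\<close>

definition unstack :: "real ^ ('n::finite \<times> 'm::finite) \<Rightarrow> real ^ 'm ^ 'n" where
  "unstack x = (\<chi> i. block x i)"

lemma linear_unstack: "linear unstack"
  by (rule linearI) (simp_all add: unstack_def block_def vec_eq_iff)

lemma bounded_linear_unstack: "bounded_linear unstack"
  using linear_unstack by (rule linear_conv_bounded_linear[THEN iffD1])

lemma inj_unstack: "unstack x = unstack y \<Longrightarrow> x = y"
  by (simp add: unstack_def block_def vec_eq_iff)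

lemma unstack_surj: "\<exists>x. unstack x = y"
  by (rule exI[of _ "\<chi> p. y $ fst p $ snd p"]) (simp add: unstack_def block_def vec_eq_iff)

lemma norm_unstack: "norm (unstack x) = norm x"
proof -
  have "(norm (unstack x))\<^sup>2 = (\<Sum>i\<in>UNIV. \<Sum>k\<in>UNIV. (x $ (i, k))\<^sup>2)"
    by (simp add: norm_sq_vec unstack_def block_def)
  also have "\<dots> = (\<Sum>p\<in>UNIV \<times> UNIV. (x $ p)\<^sup>2)" by (simp add: sum.cartesian_product)
  also have "\<dots> = (norm x)\<^sup>2" by (simp add: norm_sq_vec)
  finally show ?thesis by (simp add: power2_eq_iff_nonneg)
qed

lemma unstack_kronecker_vec_1: "unstack (kronecker_vec 1 v) = (\<chi> i. v)"
  by (simp add: unstack_def block_def kronecker_vec_def vec_eq_iff)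

lemma unstack_stacked_grad: "unstack (stacked_grad F x) = (\<chi> i. grad (F i) (unstack x $ i))"
  by (simp add: unstack_def block_def stacked_grad_def vec_eq_iff)

lemma unstack_stacked_laplacian: "unstack (stacked_laplacian A *v x) = graph_lap A (unstack x)"
proof -
  have "(stacked_laplacian A *v x) $ (i, k) = graph_lap A (unstack x) $ i $ k" for i k
  proof -
    have "(stacked_laplacian A *v x) $ (i, k) =
        (\<Sum>q\<in>UNIV \<times> UNIV. laplacian A $ i $ fst q * mat 1 $ k $ snd q * x $ q)"
      by (simp add: matrix_vector_mult_def stacked_laplacian_def kronecker_def)
    \<comment> \<open>The identity factor of the Kronecker product leaves only the term with the
      same inner coordinate.\<close>
    also have "\<dots> = (\<Sum>j\<in>UNIV. \<Sum>k'\<in>UNIV. if k = k' then laplacian A $ i $ j * x $ (j, k') else 0)"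
      by (simp only: sum.cartesian_product) (auto simp: mat_def intro!: sum.cong)
    also have "\<dots> = (\<Sum>j\<in>UNIV. laplacian A $ i $ j * x $ (j, k))" by simp
    also have "\<dots> = (\<Sum>j\<in>UNIV. (if i = j then (\<Sum>j\<in>UNIV. A $ i $ j) * x $ (i, k) else 0) - A $ i $ j * x $ (j, k))"
      by (intro sum.cong) (auto simp: laplacian_def algebra_simps)
    also have "\<dots> = (\<Sum>j\<in>UNIV. A $ i $ j * (x $ (i, k) - x $ (j, k)))"
      by (simp add: sum_subtractf right_diff_distrib sum_distrib_right)
    finally show ?thesis by (simp add: graph_lap_def unstack_def block_def)
  qed
  then show ?thesis by (simp add: vec_eq_iff unstack_def block_def)
qed

section \<open>Gradient rules and reduction of trajectories to the error system\<close>

lemma grad_sum: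
  fixes f :: "'i::finite \<Rightarrow> 'a::euclidean_space \<Rightarrow> real"
  assumes "\<And>i. f i differentiable (at x)"
  shows "grad (\<lambda>x. \<Sum>i\<in>UNIV. f i x) x = (\<Sum>i\<in>UNIV. grad (f i) x)"
  using gderiv_grad[OF assms]
  by (intro grad_eqI) (auto simp: gderiv_def inner_sum_right intro!: has_derivative_sum)

lemma grad_cmult:
  fixes g :: "'a::euclidean_space \<Rightarrow> real"
  assumes "g differentiable (at x)"
  shows "grad (\<lambda>x. c * g x) x = c *\<^sub>R grad g x"
  using gderiv_grad[OF assms]
  by (intro grad_eqI) (auto simp: gderiv_def intro!: has_derivative_mult_right)

text \<open>Subtracting a suitable equilibrium turns a trajectory into a solution of the error
  system with zero initial average of \<open>Z\<close>. Gain and rate are fixed first; only the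
  z-part of the equilibrium is chosen for each trajectory.\<close>

lemma trajectories_converge_small_gain:
  fixes f :: "'n::finite \<Rightarrow> real ^ 'm::finite \<Rightarrow> real" and A :: "real ^ 'n ^ 'n"
  assumes diff: "\<And>i x. f i differentiable (at x)"
    and lip: "\<And>i. (l i)-lipschitz_on UNIV (grad (f i))"
    and conv: "strongly_convex \<mu> (\<lambda>x. \<Sum>i\<in>UNIV. f i x)"
    and gains: "\<alpha> > 0" "\<beta> > 0" "\<alpha>\<^sup>2 > 4 * \<beta>"
    and opt: "grad (\<lambda>x. \<Sum>i\<in>UNIV. f i x) p = 0"
    and A: "weighted_digraph A" "strongly_connected A"
  shows "\<exists>\<gamma>>0. all_trajectories_converge f A \<alpha> \<beta> \<gamma> p"
proof -
  define r where "r = left_null_vector A"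
  note r = left_null_vector[OF A, folded r_def]
  define h where "h i \<xi> = grad (f i) (p + \<xi>) - grad (f i) p" for i \<xi>
  have h_lip: "norm (h i x - h i y) \<le> l i * norm (x - y)" for i x y
    using lipschitz_onD[OF lip, of "p + x" "p + y" i] by (simp add: h_def dist_norm)
  have mono: "(\<Sum>i\<in>UNIV. e \<bullet> h i e) \<ge> \<mu> * (norm e)\<^sup>2" for e
  proof -
    have "(p + e - p) \<bullet> (grad (\<lambda>x. \<Sum>i\<in>UNIV. f i x) (p + e) - grad (\<lambda>x. \<Sum>i\<in>UNIV. f i x) p)
        \<ge> \<mu> * (norm (p - (p + e)))\<^sup>2"
      using conv unfolding strongly_convex_def by blast
    then show ?thesis
      by (simp add: grad_sum diff h_def inner_sum_right inner_diff_right sum_subtractf)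
  qed
  have "\<exists>\<gamma>>0. \<exists>\<kappa>>0. \<forall>X Z. error_system A r h \<alpha> \<beta> \<gamma> X Z \<longrightarrow> weighted_avg r (Z 0) = 0 \<longrightarrow>
      (\<exists>C>0. \<forall>t\<ge>0. norm (X t) \<le> C * exp (- \<kappa> * t) \<and> norm (Z t) \<le> C * exp (- \<kappa> * t))"
    using conv
    by (intro error_system_stable[OF A r h_lip _ lipschitz_on_nonneg[OF lip] mono _ gains])
      (auto simp: h_def strongly_convex_def)
  then obtain \<gamma> \<kappa> where \<gamma>: "\<gamma> > 0" and \<kappa>: "\<kappa> > 0" and stable:
    "\<And>X Z. error_system A r h \<alpha> \<beta> \<gamma> X Z \<Longrightarrow> weighted_avg r (Z 0) = 0 \<Longrightarrow>
      \<exists>C>0. \<forall>t\<ge>0. norm (X t) \<le> C * exp (- \<kappa> * t) \<and> norm (Z t) \<le> C * exp (- \<kappa> * t)"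
    by blast
  have grad_unstack: "unstack (stacked_grad (scaled_cost f A) x) =
      (\<chi> i. (1 / r $ i) *\<^sub>R grad (f i) (unstack x $ i))" for x
    unfolding unstack_stacked_grad scaled_cost_def by (simp only: grad_cmult[OF diff] r_def)
  \<comment> \<open>The value the Laplacian must take on the z-part of an equilibrium. Its average
    vanishes because the weights cancel and the gradients at \<open>p\<close> add up to 0.\<close>
  define w where "w = - (\<gamma> *\<^sub>R (\<chi> i. (1 / r $ i) *\<^sub>R grad (f i) p))"
  have w: "weighted_avg r w = 0"
  proof -
    have "weighted_avg r w = - (\<gamma> *\<^sub>R (\<Sum>i\<in>UNIV. grad (f i) p))"
      using r(1) by (simp add: w_def weighted_avg_def sum_negf scaleR_sum_right less_imp_neq[symmetric])
    then show ?thesis using opt by (simp add: grad_sum diff)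
  qed
  have "\<exists>xs zs. equilibrium f A \<gamma> xs zs \<and> xs = kronecker_vec 1 p \<and>
      (\<exists>C>0. \<forall>t\<ge>0. norm ((x t, z t) - (xs, zs)) \<le> C * exp (- \<kappa> * t))"
    if traj: "trajectory f A \<alpha> \<beta> \<gamma> x z" for x z
  proof -
    \<comment> \<open>Since the average of z is conserved, the limit must have the average of the
      initial value.\<close>
    obtain y where y: "graph_lap A y = w" "weighted_avg r y = weighted_avg r (unstack (z 0))"
      using graph_lap_surj[OF A r w] by blast
    obtain zs where zs: "unstack zs = y" using unstack_surj by blast
    let ?xs = "kronecker_vec 1 p"
    define X where "X t = unstack (x t - ?xs)" for t
    define Z where "Z t = unstack (z t - zs)" for t
    have X: "unstack (x t) = X t + (\<chi> i. p)" and Z: "unstack (z t) = Z t + y" for t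
      by (simp_all add: X_def Z_def linear_diff[OF linear_unstack] unstack_kronecker_vec_1 zs)
    have "unstack (\<gamma> *\<^sub>R stacked_grad (scaled_cost f A) ?xs + stacked_laplacian A *v zs) = unstack 0"
      by (simp add: linear_add[OF linear_unstack] linear_scale[OF linear_unstack] grad_unstack
          unstack_stacked_laplacian unstack_kronecker_vec_1 zs y w_def linear_0[OF linear_unstack])
    moreover have "unstack (stacked_laplacian A *v ?xs) = unstack 0"
      by (simp add: unstack_stacked_laplacian unstack_kronecker_vec_1 linear_0[OF linear_unstack])
    ultimately have equi: "equilibrium f A \<gamma> ?xs zs"
      unfolding equilibrium_def by (blast dest: inj_unstack)
    have "error_system A r h \<alpha> \<beta> \<gamma> X Z"
      unfolding error_system_def
    proof (intro allI impI conjI)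
      fix t :: real assume t: "t \<ge> 0"
      have "(x has_vector_derivative - (\<gamma> *\<^sub>R stacked_grad (scaled_cost f A) (x t)) - stacked_laplacian A *v z t
          - \<alpha> *\<^sub>R (stacked_laplacian A *v x t)) (at t within {0..})"
        using traj t by (simp add: trajectory_def)
      then have "((\<lambda>t. x t - ?xs) has_vector_derivative - (\<gamma> *\<^sub>R stacked_grad (scaled_cost f A) (x t))
          - stacked_laplacian A *v z t - \<alpha> *\<^sub>R (stacked_laplacian A *v x t)) (at t within {0..})"
        by (auto intro!: derivative_eq_intros)
      then have "(X has_vector_derivative unstack (- (\<gamma> *\<^sub>R stacked_grad (scaled_cost f A) (x t))
          - stacked_laplacian A *v z t - \<alpha> *\<^sub>R (stacked_laplacian A *v x t))) (at t within {0..})"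
        unfolding X_def by (rule bounded_linear.has_vector_derivative[OF bounded_linear_unstack])
      also have "unstack (- (\<gamma> *\<^sub>R stacked_grad (scaled_cost f A) (x t))
          - stacked_laplacian A *v z t - \<alpha> *\<^sub>R (stacked_laplacian A *v x t)) =
          - (\<gamma> *\<^sub>R (\<chi> i. (1 / r $ i) *\<^sub>R grad (f i) (p + X t $ i)))
          - (graph_lap A (Z t) + w) - \<alpha> *\<^sub>R graph_lap A (X t)"
        by (simp add: linear_diff[OF linear_unstack] linear_neg[OF linear_unstack]
            linear_scale[OF linear_unstack] grad_unstack unstack_stacked_laplacian X Z
            linear_add[OF linear_graph_lap] y add.commute)
      \<comment> \<open>The term \<open>w\<close> cancels the gradients at \<open>p\<close>, leaving
        the increments \<open>h\<close>.\<close>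
      also have "\<dots> = - (\<chi> i. (\<gamma> / r $ i) *\<^sub>R h i (X t $ i)) - graph_lap A (Z t) - \<alpha> *\<^sub>R graph_lap A (X t)"
        by (simp add: w_def h_def vec_eq_iff algebra_simps)
      finally show "(X has_vector_derivative - (\<chi> i. (\<gamma> / r $ i) *\<^sub>R h i (X t $ i))
          - graph_lap A (Z t) - \<alpha> *\<^sub>R graph_lap A (X t)) (at t within {0..})" .
      have "(z has_vector_derivative \<beta> *\<^sub>R (stacked_laplacian A *v x t)) (at t within {0..})"
        using traj t by (simp add: trajectory_def)
      then have "((\<lambda>t. z t - zs) has_vector_derivative \<beta> *\<^sub>R (stacked_laplacian A *v x t)) (at t within {0..})"
        by (auto intro!: derivative_eq_intros)
      then have "(Z has_vector_derivative unstack (\<beta> *\<^sub>R (stacked_laplacian A *v x t))) (at t within {0..})"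
        unfolding Z_def by (rule bounded_linear.has_vector_derivative[OF bounded_linear_unstack])
      then show "(Z has_vector_derivative \<beta> *\<^sub>R graph_lap A (X t)) (at t within {0..})"
        by (simp add: linear_scale[OF linear_unstack] unstack_stacked_laplacian X linear_add[OF linear_graph_lap])
    qed
    moreover have "weighted_avg r (Z 0) = 0"
      using y(2) by (simp add: Z_def linear_diff[OF linear_unstack] linear_diff[OF linear_weighted_avg] zs)
    ultimately obtain C where C: "C > 0"
      "\<And>t. t \<ge> 0 \<Longrightarrow> norm (X t) \<le> C * exp (- \<kappa> * t) \<and> norm (Z t) \<le> C * exp (- \<kappa> * t)"
      using stable by blast
    \<comment> \<open>The norm of a pair is at most the sum of the norms of its components, hence
      the factor 2.\<close>
    have "norm ((x t, z t) - (?xs, zs)) \<le> (2 * C) * exp (- \<kappa> * t)" if "t \<ge> 0" for t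
      using C(2)[OF that] norm_Pair_le[of "x t - ?xs" "z t - zs"]
      by (simp add: X_def Z_def norm_unstack)
    moreover have "2 * C > 0" using C(1) by simp
    ultimately show ?thesis using equi by blast
  qed
  then show ?thesis
    unfolding all_trajectories_converge_def using \<gamma> \<kappa> by blast
qed

subsection \<open>Trading the gain for the graph\<close>

lemma laplacian_scaleR: "laplacian (k *\<^sub>R A) = k *\<^sub>R laplacian A"
  by (simp add: laplacian_def vec_eq_iff sum_distrib_left algebra_simps)

lemma vector_matrix_scaleR: "r v* (k *\<^sub>R M) = k *\<^sub>R (r v* M)" for M :: "real ^ 'n ^ 'm"
  by (simp add: vector_matrix_mult_def vec_eq_iff sum_distrib_left mult_ac)

lemma left_null_vector_scaleR: "k \<noteq> 0 \<Longrightarrow> left_null_vector (k *\<^sub>R A) = left_null_vector A"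
  by (simp add: left_null_vector_def laplacian_scaleR vector_matrix_scaleR)

lemma stacked_laplacian_scaleR_mult:
  "stacked_laplacian (k *\<^sub>R A) *v x = k *\<^sub>R (stacked_laplacian A *v x)"
  by (simp add: stacked_laplacian_def laplacian_scaleR kronecker_def matrix_vector_mult_def
      vec_eq_iff sum_distrib_left mult_ac)

text \<open>Scaling the graph and the gain by the same factor only changes the speed at which
  trajectories are run through.\<close>

lemma all_trajectories_converge_scaleR:
  assumes conv: "all_trajectories_converge f A \<alpha> \<beta> \<gamma> p" and k: "k > 0"
  shows "all_trajectories_converge f (k *\<^sub>R A) \<alpha> \<beta> (k * \<gamma>) p"
proof -
  obtain \<kappa> where \<kappa>: "\<kappa> > 0" and *: "\<And>x z. trajectory f A \<alpha> \<beta> \<gamma> x z \<Longrightarrow>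
      \<exists>xs zs. equilibrium f A \<gamma> xs zs \<and> xs = kronecker_vec 1 p \<and>
        (\<exists>C>0. \<forall>t\<ge>0. norm ((x t, z t) - (xs, zs)) \<le> C * exp (- \<kappa> * t))"
    using conv unfolding all_trajectories_converge_def by blast
  have cost: "scaled_cost f (k *\<^sub>R A) = scaled_cost f A"
    using k by (simp add: scaled_cost_def left_null_vector_scaleR fun_eq_iff)
  \<comment> \<open>The chain rule on the half-line, which division by \<open>k > 0\<close> maps
    into itself.\<close>
  have rescale: "((\<lambda>s. g (s / k)) has_vector_derivative (1 / k) *\<^sub>R g') (at s within {0..})"
    if "(g has_vector_derivative g') (at (s / k) within {0..})" for g :: "real \<Rightarrow> real ^ 'x" and g' s
  proof -
    have "((\<lambda>s. s / k) has_vector_derivative 1 / k) (at s within {0..})"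
      using k by (auto intro!: derivative_eq_intros simp: has_real_derivative_iff_has_vector_derivative[symmetric])
    moreover have "(g has_vector_derivative g') (at (s / k) within (\<lambda>s. s / k) ` {0..})"
      using that by (rule has_vector_derivative_within_subset) (use k in auto)
    ultimately show ?thesis by (auto dest: vector_diff_chain_within simp: o_def)
  qed
  have "\<exists>xs zs. equilibrium f (k *\<^sub>R A) (k * \<gamma>) xs zs \<and> xs = kronecker_vec 1 p \<and>
      (\<exists>C>0. \<forall>t\<ge>0. norm ((x t, z t) - (xs, zs)) \<le> C * exp (- (k * \<kappa>) * t))"
    if traj: "trajectory f (k *\<^sub>R A) \<alpha> \<beta> (k * \<gamma>) x z" for x z
  proof -
    have "trajectory f A \<alpha> \<beta> \<gamma> (\<lambda>s. x (s / k)) (\<lambda>s. z (s / k))"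
      unfolding trajectory_def
    proof (intro allI impI)
      fix s :: real assume "s \<ge> 0"
      then have "s / k \<ge> 0" using k by simp
      then have "(x has_vector_derivative - ((k * \<gamma>) *\<^sub>R stacked_grad (scaled_cost f A) (x (s / k)))
            - k *\<^sub>R (stacked_laplacian A *v z (s / k))
            - \<alpha> *\<^sub>R (k *\<^sub>R (stacked_laplacian A *v x (s / k)))) (at (s / k) within {0..})"
        "(z has_vector_derivative \<beta> *\<^sub>R (k *\<^sub>R (stacked_laplacian A *v x (s / k)))) (at (s / k) within {0..})"
        using traj by (simp_all add: trajectory_def cost stacked_laplacian_scaleR_mult)
      from this[THEN rescale]
      show "((\<lambda>s. x (s / k)) has_vector_derivative - (\<gamma> *\<^sub>R stacked_grad (scaled_cost f A) (x (s / k)))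
            - stacked_laplacian A *v z (s / k) - \<alpha> *\<^sub>R (stacked_laplacian A *v x (s / k))) (at s within {0..}) \<and>
          ((\<lambda>s. z (s / k)) has_vector_derivative \<beta> *\<^sub>R (stacked_laplacian A *v x (s / k))) (at s within {0..})"
        using k by (simp add: scaleR_diff_right)
    qed
    then obtain xs zs C where e: "equilibrium f A \<gamma> xs zs" "xs = kronecker_vec 1 p" and C: "C > 0"
      "\<And>t. t \<ge> 0 \<Longrightarrow> norm ((x (t / k), z (t / k)) - (xs, zs)) \<le> C * exp (- \<kappa> * t)"
      using * by blast
    have "equilibrium f (k *\<^sub>R A) (k * \<gamma>) xs zs"
      using e(1) by (simp add: equilibrium_def cost stacked_laplacian_scaleR_mult
          flip: scaleR_scaleR scaleR_add_right)
    \<comment> \<open>Time \<open>t\<close> of the scaled system is time \<open>k * t\<close> of the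
      original one, so the rate is multiplied by \<open>k\<close>.\<close>
    moreover have "norm ((x t, z t) - (xs, zs)) \<le> C * exp (- (k * \<kappa>) * t)" if "t \<ge> 0" for t
      using C(2)[of "k * t"] that k by (simp add: mult_ac)
    ultimately show ?thesis using e(2) C(1) by blast
  qed
  moreover have "k * \<kappa> > 0" using k \<kappa> by simp
  ultimately show ?thesis unfolding all_trajectories_converge_def by blast
qed

text \<open>An explicit family of admissible graphs that is closed under positive scaling; any two
  distinct nodes are joined by a single edge.\<close>

lemma complete_digraph:
  fixes k :: real
  assumes "k > 0"
  defines "A \<equiv> (\<chi> i j. if i = j then 0 else k) :: real ^ 'n ^ 'n"
  shows "weighted_digraph A" "strongly_connected A"
  using assms by (auto simp: weighted_digraph_def strongly_connected_def edges_def A_def)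

theorem theorem2:
  fixes f :: "'n::finite \<Rightarrow> real ^ 'm::finite \<Rightarrow> real"
    and l :: "'n \<Rightarrow> real"
    and \<mu> \<alpha> \<beta> :: real
  assumes "\<And>i x. f i differentiable (at x)"
    and "\<And>i. (l i)-lipschitz_on UNIV (grad (f i))"
    and "strongly_convex \<mu> (\<lambda>x. \<Sum>i\<in>UNIV. f i x)"
    and "\<alpha> > 0" and "\<beta> > 0" and "\<alpha>\<^sup>2 > 4 * \<beta>"
  shows "\<exists>xopt.
    (\<forall>y. is_arg_min (\<lambda>x. \<Sum>i\<in>UNIV. f i x) (\<lambda>_. True) y \<longleftrightarrow> y = xopt) \<and>
    (\<forall>A :: real ^ 'n ^ 'n. weighted_digraph A \<and> strongly_connected A \<longrightarrow>
       (\<exists>\<gamma>>0. all_trajectories_converge f A \<alpha> \<beta> \<gamma> xopt)) \<and>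
    (\<forall>\<gamma>>0. \<exists>A :: real ^ 'n ^ 'n. weighted_digraph A \<and> strongly_connected A \<and>
       all_trajectories_converge f A \<alpha> \<beta> \<gamma> xopt)"
proof -
  \<comment> \<open>Fixed once from the costs alone, so that it serves every graph and every
    gain.\<close>
  obtain p where grad0: "grad (\<lambda>x. \<Sum>i\<in>UNIV. f i x) p = 0"
    and opt: "\<forall>y. is_arg_min (\<lambda>x. \<Sum>i\<in>UNIV. f i x) (\<lambda>_. True) y \<longleftrightarrow> y = p"
    using strongly_convex_minimizer[OF assms(3)] by blast
  note small_gain = trajectories_converge_small_gain[OF assms grad0]
  have "\<exists>A :: real ^ 'n ^ 'n. weighted_digraph A \<and> strongly_connected A \<and>
      all_trajectories_converge f A \<alpha> \<beta> \<gamma> p" if "\<gamma> > 0" for \<gamma>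
  proof -
    define A :: "real \<Rightarrow> real ^ 'n ^ 'n" where "A k = (\<chi> i j. if i = j then 0 else k)" for k
    obtain \<gamma>\<^sub>1 where \<gamma>\<^sub>1: "\<gamma>\<^sub>1 > 0" "all_trajectories_converge f (A 1) \<alpha> \<beta> \<gamma>\<^sub>1 p"
      using small_gain[OF complete_digraph[of 1]] by (auto simp: A_def)
    \<comment> \<open>The factor that takes the gain found for unit weights to the prescribed one;
      it becomes the edge weight of the graph.\<close>
    have k: "\<gamma> / \<gamma>\<^sub>1 > 0" using that \<gamma>\<^sub>1(1) by simp
    have "(\<gamma> / \<gamma>\<^sub>1) *\<^sub>R A 1 = A (\<gamma> / \<gamma>\<^sub>1)" by (simp add: A_def vec_eq_iff)
    then have "all_trajectories_converge f (A (\<gamma> / \<gamma>\<^sub>1)) \<alpha> \<beta> \<gamma> p"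
      using all_trajectories_converge_scaleR[OF \<gamma>\<^sub>1(2) k] \<gamma>\<^sub>1(1) by simp
    then show ?thesis using complete_digraph[OF k] unfolding A_def by blast
  qed
  with opt small_gain show ?thesis by blast
qed

end
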